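(* Let $(\mathscr{M};\mathcal{H})$, $(\mathscr{N};\mathcal{K})$ be represented von Neumann algebras and $\Phi:\mathscr{M}\to\mathscr{N}$ be a unital normal $*$-homomorphism. Let $\Phi_{\mathrm{aff}}:\mathscr{M}_{\mathrm{aff}}\to\mathscr{N}_{\mathrm{aff}}$ be the extension of $\Phi$ given by $\Phi_{\mathrm{aff}}(A/B)=\Phi(A)/\Phi(B)$. Let $T\in\mathscr{M}_{\mathrm{aff}}$. (i) Then $\mathrm{dom}\big(\Phi_{\mathrm{aff}}(T)\big)=\Phi^s_{\mathrm{aff}}\big(\mathrm{dom}(T)\big)$. If $T$ is densely-defined, then so is $\Phi_{\mathrm{aff}}(T)$. (ii) If $T$ is closed and bounded (on its domain), then so is $\Phi_{\mathrm{aff}}(T)$. (iii) If $T$ is closed, then so is $\Phi_{\mathrm{aff}}(T)$. (iv) If $T$ is pre-closed, then so is $\Phi_{\mathrm{aff}}(T)$. Furthermore, $\overline{T}\in\mathscr{M}_{\mathrm{aff}}$ and $\Phi_{\mathrm{aff}}(\overline{T})=\overline{\Phi_{\mathrm{aff}}(T)}$. Thus $\Phi_{\mathrm{aff}}$ maps $\mathscr{M}_{\mathrm{aff}}^{\mathrm{MvN}}$ into $\mathscr{N}_{\mathrm{aff}}^{\mathrm{MvN}}$, and in fact sends densely-defined closed affiliated operators for $\mathscr{M}$ to densely-defined closed affiliated operators for $\mathscr{N}$.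
   Context: A represented von Neumann algebra $(\mathscr{M};\mathcal{H})$ is a von Neumann algebra $\mathscr{M}$ acting on a complex Hilbert space $\mathcal{H}$. An unbounded operator on $\mathcal{H}$ is a linear map $T:\mathrm{dom}(T)\to\mathcal{H}$ with $\mathrm{dom}(T)$ a (not necessarily dense) linear subspace of $\mathcal{H}$, and $T$ not necessarily bounded; equality of operators includes equality of domains. $T$ is closed if its graph is closed in $\mathcal{H}\oplus\mathcal{H}$, and pre-closed if the closure of its graph is the graph of an operator, denoted $\overline{T}$. For $A,B\in\mathcal{B}(\mathcal{H})$ with $\mathrm{null}(B)\subseteq\mathrm{null}(A)$, the quotient $A/B$ is the unbounded operator with domain $\mathrm{ran}(B)$ given by $Bx\mapsto Ax$ ($x\in\mathcal{H}$). $\mathscr{M}_{\mathrm{aff}} := \{A/B : A,B\in\mathscr{M},\ \mathrm{null}(B)\subseteq\mathrm{null}(A)\}$. The map $\Phi_{\mathrm{aff}}$, $A/B\mapsto\Phi(A)/\Phi(B)$, makes sense and does not depend on the choice of quotient representation. $\mathscr{M}_{\mathrm{aff}}^{\mathrm{MvN}}$ is the set of closed operators $T$ on $\mathcal{H}$ with $U^*TU=T$ for every unitary $U\in\mathscr{M}'$; it coincides with the set of closed operators in $\mathscr{M}_{\mathrm{aff}}$. $\mathrm{Aff}_s(\mathscr{M})$ is the set of subspaces of $\mathcal{H}$ of the form $\mathrm{ran}(A)$ with $A\in\mathscr{M}$, and $\Phi^s_{\mathrm{aff}}:\mathrm{Aff}_s(\mathscr{M})\to\mathrm{Aff}_s(\mathscr{N})$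 is the well-defined map $\mathrm{ran}(A)\mapsto\mathrm{ran}(\Phi(A))$. *)

theory Defs
  imports "HOL-Analysis.Analysis"
begin

section \<open>Complex Hilbert spaces\<close>

text \<open>The real inner product and the norm of the underlying real Hilbert space are the ones
  induced by \<open>cinner\<close>, which is linear in its first argument. The complex Hilbert space
  is the whole type; completeness comes from \<open>complete_space\<close>.\<close>

class complex_hilbert = real_inner + complete_space +
  fixes scaleC :: "complex \<Rightarrow> 'a \<Rightarrow> 'a"  (infixr "*\<^sub>C" 75)
    and cinner :: "'a \<Rightarrow> 'a \<Rightarrow> complex"
  assumes scaleC_add_right: "c *\<^sub>C (x + y) = c *\<^sub>C x + c *\<^sub>C y"
    and scaleC_add_left: "(c + d) *\<^sub>C x = c *\<^sub>C x + d *\<^sub>C x"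
    and scaleC_scaleC: "c *\<^sub>C d *\<^sub>C x = (c * d) *\<^sub>C x"
    and scaleR_scaleC: "scaleR r x = complex_of_real r *\<^sub>C x"
    and cinner_commute: "cinner x y = cnj (cinner y x)"
    and cinner_add_left: "cinner (x + y) z = cinner x z + cinner y z"
    and cinner_scaleC_left: "cinner (c *\<^sub>C x) y = c * cinner x y"
    and inner_eq_Re_cinner: "inner x y = Re (cinner x y)"

instantiation complex :: complex_hilbert
begin

definition scaleC_complex :: "complex \<Rightarrow> complex \<Rightarrow> complex" where
  "scaleC_complex c x = c * x"

definition cinner_complex :: "complex \<Rightarrow> complex \<Rightarrow> complex" where
  "cinner_complex x y = x * cnj y"

instance
  by standard
    (auto simp: scaleC_complex_def cinner_complex_def inner_complex_def algebra_simps
      scaleR_conv_of_real)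

end

section \<open>Bounded operators and von Neumann algebras\<close>

definition bounded_op :: "('a::complex_hilbert \<Rightarrow> 'b::complex_hilbert) \<Rightarrow> bool" where
  "bounded_op A \<longleftrightarrow> bounded_linear A \<and> (\<forall>c x. A (c *\<^sub>C x) = c *\<^sub>C A x)"

text \<open>For bounded \<open>A\<close> the adjoint exists by the Riesz representation theorem.\<close>

definition cadjoint :: "('a::complex_hilbert \<Rightarrow> 'a) \<Rightarrow> ('a \<Rightarrow> 'a)" where
  "cadjoint A = (THE B. \<forall>x y. cinner (A x) y = cinner x (B y))"

definition unitary_op :: "('a::complex_hilbert \<Rightarrow> 'a) \<Rightarrow> bool" where
  "unitary_op U \<longleftrightarrow> bounded_op U \<and> cadjoint U \<circ> U = id \<and> U \<circ> cadjoint U = id"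

definition commutant :: "('a::complex_hilbert \<Rightarrow> 'a) set \<Rightarrow> ('a \<Rightarrow> 'a) set" where
  "commutant S = {T. bounded_op T \<and> (\<forall>A\<in>S. T \<circ> A = A \<circ> T)}"

text \<open>Dixmier's definition. A commutant consists of bounded operators and is a unital algebra,
  so the second conjunct already makes \<open>M\<close> a unital subalgebra of the bounded operators.\<close>

definition von_neumann_algebra :: "('a::complex_hilbert \<Rightarrow> 'a) set \<Rightarrow> bool" where
  "von_neumann_algebra M \<longleftrightarrow> (\<forall>A\<in>M. cadjoint A \<in> M) \<and> commutant (commutant M) = M"

definition selfadjoint_part :: "('a::complex_hilbert \<Rightarrow> 'a) set \<Rightarrow> ('a \<Rightarrow> 'a) set" where
  "selfadjoint_part M = {A \<in> M. cadjoint A = A}"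

definition op_le :: "('a::complex_hilbert \<Rightarrow> 'a) \<Rightarrow> ('a \<Rightarrow> 'a) \<Rightarrow> bool" where
  "op_le A B \<longleftrightarrow> (\<forall>x. cinner (B x - A x) x \<in> \<real>\<^sub>\<ge>\<^sub>0)"

definition is_op_sup ::
    "('a::complex_hilbert \<Rightarrow> 'a) set \<Rightarrow> ('a \<Rightarrow> 'a) set \<Rightarrow> ('a \<Rightarrow> 'a) \<Rightarrow> bool" where
  "is_op_sup M D A \<longleftrightarrow> A \<in> selfadjoint_part M \<and> (\<forall>X\<in>D. op_le X A) \<and>
     (\<forall>C\<in>selfadjoint_part M. (\<forall>X\<in>D. op_le X C) \<longrightarrow> op_le A C)"

definition star_homomorphism ::
    "('a::complex_hilbert \<Rightarrow> 'a) set \<Rightarrow> ('b::complex_hilbert \<Rightarrow> 'b) set \<Rightarrow>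
     (('a \<Rightarrow> 'a) \<Rightarrow> ('b \<Rightarrow> 'b)) \<Rightarrow> bool" where
  "star_homomorphism M N \<Phi> \<longleftrightarrow> \<Phi> \<in> M \<rightarrow> N \<and>
     (\<forall>A\<in>M. \<forall>B\<in>M. \<Phi> (\<lambda>x. A x + B x) = (\<lambda>y. \<Phi> A y + \<Phi> B y)) \<and>
     (\<forall>c. \<forall>A\<in>M. \<Phi> (\<lambda>x. c *\<^sub>C A x) = (\<lambda>y. c *\<^sub>C \<Phi> A y)) \<and>
     (\<forall>A\<in>M. \<forall>B\<in>M. \<Phi> (A \<circ> B) = \<Phi> A \<circ> \<Phi> B) \<and>
     (\<forall>A\<in>M. \<Phi> (cadjoint A) = cadjoint (\<Phi> A))"

definition unital_map :: "(('a \<Rightarrow> 'a) \<Rightarrow> ('b \<Rightarrow> 'b)) \<Rightarrow> bool" where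
  "unital_map \<Phi> \<longleftrightarrow> \<Phi> id = id"

text \<open>Normality: suprema of bounded increasing nets of self-adjoint elements are preserved. Such a
  net is represented by its range, an upward directed set; having a supremum, it is bounded.\<close>

definition normal_map ::
    "('a::complex_hilbert \<Rightarrow> 'a) set \<Rightarrow> ('b::complex_hilbert \<Rightarrow> 'b) set \<Rightarrow>
     (('a \<Rightarrow> 'a) \<Rightarrow> ('b \<Rightarrow> 'b)) \<Rightarrow> bool" where
  "normal_map M N \<Phi> \<longleftrightarrow>
     (\<forall>D A. D \<subseteq> selfadjoint_part M \<and> D \<noteq> {} \<and>
        (\<forall>X\<in>D. \<forall>Y\<in>D. \<exists>Z\<in>D. op_le X Z \<and> op_le Y Z) \<and> is_op_sup M D A
        \<longrightarrow> is_op_sup N (\<Phi> ` D) (\<Phi> A))"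

section \<open>Unbounded operators\<close>

text \<open>An unbounded operator is a partial function \<open>T\<close> with domain \<open>dom T\<close>, so that equality of
  operators includes equality of domains. The topology on pairs is that of the Hilbert space
  direct sum.\<close>

definition unbounded_op :: "('a::complex_hilbert \<rightharpoonup> 'a) \<Rightarrow> bool" where
  "unbounded_op T \<longleftrightarrow> T 0 = Some 0 \<and>
     (\<forall>x y u v. T x = Some u \<and> T y = Some v \<longrightarrow> T (x + y) = Some (u + v)) \<and>
     (\<forall>c x u. T x = Some u \<longrightarrow> T (c *\<^sub>C x) = Some (c *\<^sub>C u))"

definition closed_op :: "('a::complex_hilbert \<rightharpoonup> 'a) \<Rightarrow> bool" where
  "closed_op T \<longleftrightarrow> unbounded_op T \<and> closed (Map.graph T)"

definition preclosed_op :: "('a::complex_hilbert \<rightharpoonup> 'a) \<Rightarrow> bool" where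
  "preclosed_op T \<longleftrightarrow> unbounded_op T \<and>
     (\<exists>S. unbounded_op S \<and> Map.graph S = closure (Map.graph T))"

definition op_closure :: "('a::complex_hilbert \<rightharpoonup> 'a) \<Rightarrow> ('a \<rightharpoonup> 'a)" where
  "op_closure T = (THE S. unbounded_op S \<and> Map.graph S = closure (Map.graph T))"

definition bounded_on_dom :: "('a::complex_hilbert \<rightharpoonup> 'a) \<Rightarrow> bool" where
  "bounded_on_dom T \<longleftrightarrow> (\<exists>K. \<forall>x y. T x = Some y \<longrightarrow> norm y \<le> K * norm x)"

definition densely_defined :: "('a::complex_hilbert \<rightharpoonup> 'a) \<Rightarrow> bool" where
  "densely_defined T \<longleftrightarrow> closure (dom T) = UNIV"

section \<open>Quotients and affiliated operators\<close>

definition null_space :: "('a::complex_hilbert \<Rightarrow> 'a) \<Rightarrow> 'a set" where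
  "null_space A = {x. A x = 0}"

text \<open>The description is well defined only if \<open>null_space B \<subseteq> null_space A\<close>.\<close>

definition quotient_op :: "('a::complex_hilbert \<Rightarrow> 'a) \<Rightarrow> ('a \<Rightarrow> 'a) \<Rightarrow> ('a \<rightharpoonup> 'a)" where
  "quotient_op A B =
     (\<lambda>y. if y \<in> range B then Some (THE z. \<exists>x. B x = y \<and> z = A x) else None)"

definition M_aff :: "('a::complex_hilbert \<Rightarrow> 'a) set \<Rightarrow> ('a \<rightharpoonup> 'a) set" where
  "M_aff M = {quotient_op A B | A B. A \<in> M \<and> B \<in> M \<and> null_space B \<subseteq> null_space A}"

text \<open>The unique operator arising as \<open>\<Phi>(A)/\<Phi>(B)\<close> from some quotient
  representation \<open>A/B\<close> of \<open>T\<close> over \<open>M\<close>.\<close>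

definition Phi_aff ::
    "('a::complex_hilbert \<Rightarrow> 'a) set \<Rightarrow> (('a \<Rightarrow> 'a) \<Rightarrow> ('b::complex_hilbert \<Rightarrow> 'b)) \<Rightarrow>
     ('a \<rightharpoonup> 'a) \<Rightarrow> ('b \<rightharpoonup> 'b)" where
  "Phi_aff M \<Phi> T = (THE S. \<exists>A\<in>M. \<exists>B\<in>M. null_space B \<subseteq> null_space A \<and>
     T = quotient_op A B \<and> S = quotient_op (\<Phi> A) (\<Phi> B))"

text \<open>The map \<open>ran(A) \<mapsto> ran(\<Phi>(A))\<close>, for \<open>A \<in> M\<close>, on affiliated subspaces.\<close>

definition Phi_aff_s ::
    "('a::complex_hilbert \<Rightarrow> 'a) set \<Rightarrow> (('a \<Rightarrow> 'a) \<Rightarrow> ('b::complex_hilbert \<Rightarrow> 'b)) \<Rightarrow>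
     'a set \<Rightarrow> 'b set" where
  "Phi_aff_s M \<Phi> V = (THE W. \<exists>A\<in>M. V = range A \<and> W = range (\<Phi> A))"

text \<open>The composition below is \<open>U\<^sup>* T U\<close> with its maximal domain \<open>{x. U x \<in> dom T}\<close>.\<close>

definition M_aff_MvN :: "('a::complex_hilbert \<Rightarrow> 'a) set \<Rightarrow> ('a \<rightharpoonup> 'a) set" where
  "M_aff_MvN M = {T. closed_op T \<and>
     (\<forall>U\<in>commutant M. unitary_op U \<longrightarrow> map_option (cadjoint U) \<circ> T \<circ> U = T)}"

end

theory Submission
  imports Defs
begin

text \<open>Everything is reduced to algebraic relations between elements of \<open>M\<close>, which \<open>\<Phi>\<close> preserves.
  Range inclusions are factorizations \<open>A = B C\<close> (Douglas), so \<open>A/B\<close> determines \<open>\<Phi>(A)/\<Phi>(B)\<close>. The quotient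
  \<open>A/B\<close> is closed iff \<open>L\<^sub>1 B + L\<^sub>2 A = P\<close> for some \<open>L\<^sub>1, L\<^sub>2 \<in> M\<close>, where \<open>1 - P\<close> is the projection onto
  the kernel of \<open>B\<close>. Normality is needed for kernels and closures of ranges only: the projection
  onto the kernel of \<open>B\<close> is the decreasing limit of the scaled resolvents
  \<open>\<epsilon> (B\<^sup>* B + \<epsilon>)\<^sup>-\<^sup>1\<close>, hence \<open>\<Phi>\<close> maps it to the projection onto the kernel of \<open>\<Phi>(B)\<close>.

  Operators in \<open>M\<close> are produced as single-valued closed subspaces of direct sums, bounded by the
  closed graph theorem and invariant under the commutant, hence in the bicommutant. Since the
  scalars lie in the commutant, only the underlying real Hilbert spaces matter for this.\<close>

section \<open>Real Hilbert spaces\<close>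

text \<open>\<open>\<Phi>\<close> moves operators and no vectors, so a topological property of
  \<open>T\<close> can be transported only after it has been rewritten as an identity in
  \<open>M\<close>. For closedness the rewriting comes from the map
  \<open>x \<mapsto> (B x, A x)\<close>: its kernel is \<open>null_space B\<close> and its range is
  the graph of \<open>A/B\<close>, so the range is closed exactly when the map has a bounded left
  inverse modulo the kernel, and \<open>L1\<close>, \<open>L2\<close> are the two entries of that
  inverse. If \<open>T\<close> is bounded as well, its domain is closed and \<open>T\<close> is the
  restriction of some \<open>C\<close> in \<open>M\<close>, that is, \<open>A = C \<circ> B\<close>.
  Closures are the harder case, since a closed graph arrives without numerator and denominator. A
  partial isometry onto that graph which commutes with the commutant supplies both as its
  components. The same construction handles \<open>M_aff_MvN\<close>, except that its definition
  tests invariance against unitaries only, so these have to be shown to span the commutant.\<close>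

instance complex_hilbert \<subseteq> banach ..

definition closed_subspace :: "'a::real_normed_vector set \<Rightarrow> bool" where
  "closed_subspace S \<longleftrightarrow> subspace S \<and> closed S"

lemma in_orthogonal_comp: "x \<in> W\<^sup>\<bottom> \<longleftrightarrow> (\<forall>y\<in>W. inner x y = 0)"
  by (auto simp: orthogonal_comp_def orthogonal_def inner_commute)

lemma inner_left_eqI: "(\<And>z. inner x z = inner y z) \<Longrightarrow> x = y"
  using vector_eq_rdot by blast

lemma inner_right_eqI: "(\<And>z. inner z x = inner z y) \<Longrightarrow> x = y"
  using vector_eq_ldot by blast

section \<open>Nearest points and orthogonal projections\<close>

lemma parallelogram:
  fixes a b :: "'a::real_inner"
  shows "(norm (a - b))\<^sup>2 = 2 * (norm a)\<^sup>2 + 2 * (norm b)\<^sup>2 - (norm (a + b))\<^sup>2"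
  by (simp add: power2_norm_eq_inner inner_diff inner_add inner_commute algebra_simps)

text \<open>Midpoints of elements of \<open>S\<close> stay in \<open>S\<close>, so the parallelogram
  law makes a minimizing sequence Cauchy. Squared distances are used because the law speaks about
  squares.\<close>

lemma nearest_point_exists:
  fixes S :: "'a::{real_inner,banach} set"
  assumes S: "closed_subspace S"
  shows "\<exists>p\<in>S. \<forall>s\<in>S. (norm (x - p))\<^sup>2 \<le> (norm (x - s))\<^sup>2"
proof -
  have sub: "subspace S" and cl: "closed S" using S by (auto simp: closed_subspace_def)
  define D where "D = (INF s\<in>S. (norm (x - s))\<^sup>2)"
  have ne: "S \<noteq> {}" using sub subspace_0 by blast
  have bdd: "bdd_below ((\<lambda>s. (norm (x - s))\<^sup>2) ` S)" by (rule bdd_belowI2[of _ 0]) auto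
  have D_le: "D \<le> (norm (x - s))\<^sup>2" if "s \<in> S" for s
    unfolding D_def using bdd that by (rule cINF_lower)
  have "\<exists>s\<in>S. (norm (x - s))\<^sup>2 < D + 1 / (real n + 1)" for n
    using cINF_less_iff[OF ne bdd, of "D + 1 / (real n + 1)"] unfolding D_def by auto
  then obtain s where sS: "\<And>n. s n \<in> S" and s: "\<And>n. (norm (x - s n))\<^sup>2 < D + 1 / (real n + 1)"
    by metis
  have dist: "(norm (s m - s n))\<^sup>2 \<le> 2 / (real m + 1) + 2 / (real n + 1)" for m n
  proof -
    have "(1/2) *\<^sub>R (s m + s n) \<in> S" using sub sS by (simp add: subspace_add subspace_scale)
    then have "D \<le> (norm (x - (1/2) *\<^sub>R (s m + s n)))\<^sup>2" by (rule D_le)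
    also have "x - (1/2) *\<^sub>R (s m + s n) = (1/2) *\<^sub>R ((x - s m) + (x - s n))"
      by (simp add: algebra_simps flip: scaleR_add_left)
    finally have "4 * D \<le> (norm ((x - s m) + (x - s n)))\<^sup>2"
      by (simp add: power_divide)
    moreover have "(norm (s m - s n))\<^sup>2 = (norm ((x - s m) - (x - s n)))\<^sup>2"
      by (simp add: norm_minus_commute)
    ultimately show ?thesis
      using s[of m] s[of n] unfolding parallelogram[of "x - s m" "x - s n"] by simp
  qed
  have "Cauchy s"
  proof (rule metric_CauchyI)
    fix e :: real assume "e > 0"
    obtain N where N: "4 / e\<^sup>2 < real N" using reals_Archimedean2 by blast
    have "dist (s m) (s n) < e" if "m \<ge> N" "n \<ge> N" for m n
    proof -
      have e2: "e\<^sup>2 > 0" using \<open>e > 0\<close> by simp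
      have h: "2 / (real k + 1) < e\<^sup>2 / 2" if "k \<ge> N" for k
      proof -
        have "4 / e\<^sup>2 < real k + 1" using N that by simp
        then have "4 < (real k + 1) * e\<^sup>2" using e2 by (simp add: pos_divide_less_eq)
        then show ?thesis by (simp add: field_simps)
      qed
      have "(norm (s m - s n))\<^sup>2 < e\<^sup>2"
        using dist[of m n] h[OF that(1)] h[OF that(2)] by simp
      then show ?thesis using \<open>e > 0\<close> by (simp add: dist_norm power_less_imp_less_base)
    qed
    then show "\<exists>M. \<forall>m\<ge>M. \<forall>n\<ge>M. dist (s m) (s n) < e" by blast
  qed
  then obtain p where p: "s \<longlonglongrightarrow> p" using Cauchy_convergent convergent_def by blast
  have "p \<in> S" using cl sS p closed_sequentially by blast
  have "(\<lambda>n. (norm (x - s n))\<^sup>2) \<longlonglongrightarrow> (norm (x - p))\<^sup>2" by (intro tendsto_intros p)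
  moreover have "(\<lambda>n. D + 1 / (real n + 1)) \<longlonglongrightarrow> D + 0"
    using LIMSEQ_inverse_real_of_nat by (intro tendsto_intros) (simp add: inverse_eq_divide add.commute)
  ultimately have le: "(norm (x - p))\<^sup>2 \<le> D + 0"
    by (rule LIMSEQ_le) (use s less_imp_le in blast)
  show ?thesis
  proof (intro bexI ballI)
    fix s assume "s \<in> S"
    from D_le[OF this] le show "(norm (x - p))\<^sup>2 \<le> (norm (x - s))\<^sup>2" by linarith
  qed fact
qed

text \<open>First variation: if the residual at a nearest point had a component along some
  \<open>s\<close> in \<open>S\<close>, moving the point along \<open>s\<close> would bring it
  closer.\<close>

proposition orthogonal_projection_exists:
  fixes S :: "'a::{real_inner,banach} set"
  assumes S: "closed_subspace S"
  shows "\<exists>p\<in>S. x - p \<in> S\<^sup>\<bottom>"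
proof -
  obtain p where p: "p \<in> S" and min: "\<And>s. s \<in> S \<Longrightarrow> (norm (x - p))\<^sup>2 \<le> (norm (x - s))\<^sup>2"
    using nearest_point_exists[OF S] by blast
  have "inner (x - p) s = 0" if s: "s \<in> S" for s
  proof (cases "s = 0")
    case False
    \<comment> \<open>This \<open>t\<close> minimizes the quadratic
      \<open>t \<mapsto> (norm ((x - p) - t *\<^sub>R s))\<^sup>2\<close>, lowering its value at 0
      by \<open>(inner (x - p) s)\<^sup>2 / (norm s)\<^sup>2\<close>.\<close>
    define t where "t = inner (x - p) s / (norm s)\<^sup>2"
    have ns: "(norm s)\<^sup>2 > 0" using False by simp
    have "p + t *\<^sub>R s \<in> S" using S p s by (simp add: closed_subspace_def subspace_add subspace_scale)
    then have "(norm (x - p))\<^sup>2 \<le> (norm ((x - p) - t *\<^sub>R s))\<^sup>2" using min by (simp add: diff_diff_add)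
    also have "\<dots> = (norm (x - p))\<^sup>2 - 2 * t * inner (x - p) s + t\<^sup>2 * (norm s)\<^sup>2"
      unfolding power2_norm_eq_inner inner_diff_left[of "x - p" "t *\<^sub>R s"] inner_diff_right[of _ "x - p" "t *\<^sub>R s"]
      by (simp add: inner_commute power2_eq_square)
    also have "t\<^sup>2 * (norm s)\<^sup>2 = t * inner (x - p) s"
      using ns by (simp add: t_def power2_eq_square field_simps)
    also have "t * inner (x - p) s = (inner (x - p) s)\<^sup>2 / (norm s)\<^sup>2"
      by (simp add: t_def power2_eq_square)
    finally have "(inner (x - p) s)\<^sup>2 / (norm s)\<^sup>2 \<le> 0"
      by (simp add: t_def power2_eq_square)
    then show ?thesis using ns by (simp add: divide_le_0_iff)
  qed simp
  then show ?thesis using p by (auto simp: in_orthogonal_comp)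
qed

definition oproj :: "'a::{real_inner,banach} set \<Rightarrow> 'a \<Rightarrow> 'a" where
  "oproj S x = (THE p. p \<in> S \<and> x - p \<in> S\<^sup>\<bottom>)"

lemma oproj_unique:
  assumes "subspace S" "p \<in> S" "x - p \<in> S\<^sup>\<bottom>"
  shows "oproj S x = p"
  unfolding oproj_def
proof (rule the_equality)
  fix q assume q: "q \<in> S \<and> x - q \<in> S\<^sup>\<bottom>"
  have "q - p \<in> S" using assms q by (simp add: subspace_diff)
  then have "inner (x - p) (q - p) = 0" "inner (x - q) (q - p) = 0"
    using assms(3) q by (auto simp: in_orthogonal_comp)
  then have "inner (q - p) (q - p) = 0" by (simp add: inner_diff)
  then show "q = p" by simp
qed (use assms in auto)

context
  fixes S :: "'a::{real_inner,banach} set"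
  assumes S: "closed_subspace S"
begin

lemma oproj: shows oproj_in: "oproj S x \<in> S" and oproj_perp: "x - oproj S x \<in> S\<^sup>\<bottom>"
proof -
  obtain p where "p \<in> S" "x - p \<in> S\<^sup>\<bottom>" using orthogonal_projection_exists[OF S] by blast
  moreover from this have "oproj S x = p" using S by (intro oproj_unique) (auto simp: closed_subspace_def)
  ultimately show "oproj S x \<in> S" "x - oproj S x \<in> S\<^sup>\<bottom>" by auto
qed

lemma oproj_eqI: "p \<in> S \<Longrightarrow> x - p \<in> S\<^sup>\<bottom> \<Longrightarrow> oproj S x = p"
  using S by (intro oproj_unique) (auto simp: closed_subspace_def)

lemma oproj_fix: "x \<in> S \<Longrightarrow> oproj S x = x"
  by (rule oproj_eqI) (auto simp: in_orthogonal_comp)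

lemma oproj_zero: "x \<in> S\<^sup>\<bottom> \<Longrightarrow> oproj S x = 0"
  using S by (intro oproj_eqI) (auto simp: closed_subspace_def subspace_0)

lemma oproj_selfadjoint: "inner (oproj S x) y = inner x (oproj S y)"
proof -
  have "inner (x - oproj S x) (oproj S y) = 0" "inner (y - oproj S y) (oproj S x) = 0"
    using oproj by (auto simp: in_orthogonal_comp)
  then show ?thesis by (simp add: inner_diff inner_commute)
qed

lemma norm_oproj_le: "norm (oproj S x) \<le> norm x"
proof -
  have "inner (x - oproj S x) (oproj S x) = 0" using oproj by (auto simp: in_orthogonal_comp)
  then have "(norm (oproj S x))\<^sup>2 = inner x (oproj S x)"
    by (simp add: inner_diff power2_norm_eq_inner)
  also have "\<dots> \<le> norm x * norm (oproj S x)" by (rule norm_cauchy_schwarz)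
  finally show ?thesis by (cases "oproj S x = 0") (auto simp: power2_eq_square)
qed

lemma bounded_linear_oproj: "bounded_linear (oproj S)"
proof (rule bounded_linear_intro[where K = 1])
  fix x y :: 'a and r :: real
  have sub: "subspace S" "subspace (S\<^sup>\<bottom>)" using S subspace_orthogonal_comp by (auto simp: closed_subspace_def)
  have "x + y - (oproj S x + oproj S y) \<in> S\<^sup>\<bottom>"
    using subspace_add[OF sub(2) oproj_perp[of x] oproj_perp[of y]] by (simp add: algebra_simps)
  then show "oproj S (x + y) = oproj S x + oproj S y"
    by (intro oproj_eqI subspace_add[OF sub(1)] oproj_in)
  have "r *\<^sub>R x - (r *\<^sub>R oproj S x) \<in> S\<^sup>\<bottom>"
    using subspace_scale[OF sub(2) oproj_perp[of x], of r] by (simp add: scaleR_diff_right)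
  then show "oproj S (r *\<^sub>R x) = r *\<^sub>R oproj S x"
    by (intro oproj_eqI subspace_scale[OF sub(1)] oproj_in)
  show "norm (oproj S x) \<le> norm x * 1" using norm_oproj_le by simp
qed

end

lemma norm_oproj_diff_le:
  fixes S :: "'a::{real_inner,banach} set"
  assumes S: "closed_subspace S"
  shows "norm (x - oproj S x) \<le> norm x"
proof -
  have "inner (x - oproj S x) (oproj S x) = 0"
    using oproj_in[OF S] oproj_perp[OF S, of x] unfolding in_orthogonal_comp by blast
  then have "(norm (x - oproj S x))\<^sup>2 = inner x (x - oproj S x)"
    by (simp add: inner_diff inner_commute power2_norm_eq_inner)
  also have "\<dots> \<le> norm x * norm (x - oproj S x)" by (rule norm_cauchy_schwarz)
  finally show ?thesis by (cases "x - oproj S x = 0") (auto simp: power2_eq_square)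
qed

lemma subspace_closure:
  fixes S :: "'a::real_normed_vector set"
  assumes S: "subspace S"
  shows "subspace (closure S)"
proof (rule subspaceI)
  show "0 \<in> closure S" using subspace_0[OF S] closure_subset by blast
next
  fix x y assume "x \<in> closure S" "y \<in> closure S"
  then obtain a b where ab: "\<And>n. a n \<in> S" "a \<longlonglongrightarrow> x" "\<And>n. b n \<in> S" "b \<longlonglongrightarrow> y"
    by (metis closure_sequential)
  then have "(\<lambda>n. a n + b n) \<longlonglongrightarrow> x + y" "\<And>n. a n + b n \<in> S"
    by (auto intro: tendsto_add subspace_add[OF S])
  then show "x + y \<in> closure S" unfolding closure_sequential by (intro exI[of _ "\<lambda>n. a n + b n"]) simp
next
  fix c :: real and x assume "x \<in> closure S"
  then obtain a where a: "\<And>n. a n \<in> S" "a \<longlonglongrightarrow> x" by (metis closure_sequential)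
  then have "(\<lambda>n. c *\<^sub>R a n) \<longlonglongrightarrow> c *\<^sub>R x" "\<And>n. c *\<^sub>R a n \<in> S"
    by (auto intro: tendsto_intros subspace_scale[OF S])
  then show "c *\<^sub>R x \<in> closure S" unfolding closure_sequential by (intro exI[of _ "\<lambda>n. c *\<^sub>R a n"]) simp
qed

lemma closed_subspace_closure: "subspace S \<Longrightarrow> closed_subspace (closure S)"
  by (simp add: closed_subspace_def subspace_closure)

text \<open>The residual of \<open>x\<close> at its projection onto the closure is itself orthogonal
  to \<open>S\<close>, so the right-hand side forces it to vanish. Density is tested in this form
  throughout; for the range of an operator the orthogonal vectors are the kernel of its
  adjoint.\<close>

lemma in_closure_subspace_iff:
  fixes S :: "'a::{real_inner,banach} set"
  assumes "subspace S"
  shows "x \<in> closure S \<longleftrightarrow> (\<forall>y\<in>S\<^sup>\<bottom>. inner x y = 0)"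
proof
  assume "x \<in> closure S"
  then obtain s where s: "\<And>n. s n \<in> S" "s \<longlonglongrightarrow> x" using closure_sequential by metis
  show "\<forall>y\<in>S\<^sup>\<bottom>. inner x y = 0"
  proof
    fix y assume "y \<in> S\<^sup>\<bottom>"
    then have "\<And>n. inner (s n) y = 0" using s by (auto simp: in_orthogonal_comp inner_commute)
    moreover have "(\<lambda>n. inner (s n) y) \<longlonglongrightarrow> inner x y" by (intro tendsto_intros s)
    ultimately show "inner x y = 0" using LIMSEQ_unique tendsto_const by (metis (no_types, lifting) ext)
  qed
next
  assume x: "\<forall>y\<in>S\<^sup>\<bottom>. inner x y = 0"
  note C = closed_subspace_closure[OF assms]
  let ?u = "x - oproj (closure S) x"
  have "?u \<in> S\<^sup>\<bottom>" using oproj_perp[OF C, of x] closure_subset by (auto simp: in_orthogonal_comp)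
  then have "inner x ?u = 0" using x by auto
  moreover have "inner (oproj (closure S) x) ?u = 0"
    using oproj[OF C, of x] by (auto simp: in_orthogonal_comp inner_commute)
  ultimately have "inner ?u ?u = 0" by (simp add: inner_diff_left)
  then have "x = oproj (closure S) x" by simp
  then show "x \<in> closure S" using oproj_in[OF C] by metis
qed

section \<open>Riesz representation and adjoints\<close>

text \<open>The kernel of a nonzero \<open>f\<close> has codimension one: modulo the kernel every
  \<open>x\<close> is a multiple of a single vector \<open>u\<close> orthogonal to it, and rescaling
  \<open>u\<close> represents \<open>f\<close>.\<close>

theorem riesz_representation:
  fixes f :: "'a::{real_inner,banach} \<Rightarrow> real"
  assumes "bounded_linear f"
  shows "\<exists>a. \<forall>x. f x = inner x a"
proof (cases "\<forall>x. f x = 0")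
  case True
  then show ?thesis by (intro exI[of _ 0]) simp
next
  case False
  then obtain x0 where x0: "f x0 \<noteq> 0" by blast
  interpret bounded_linear f by fact
  let ?S = "{x. f x = 0}"
  have S: "closed_subspace ?S"
    by (auto simp: closed_subspace_def subspace_def add scaleR zero
        intro!: closed_Collect_eq continuous_intros linear_continuous_on assms)
  define u where "u = x0 - oproj ?S x0"
  have fu: "f u \<noteq> 0" using oproj_in[OF S, of x0] x0 by (simp add: u_def diff)
  then have "u \<noteq> 0" using zero by auto
  have "f x = inner x ((f u / (norm u)\<^sup>2) *\<^sub>R u)" for x
  proof -
    have "x - (f x / f u) *\<^sub>R u \<in> ?S" using fu by (simp add: diff scaleR)
    then have "inner u (x - (f x / f u) *\<^sub>R u) = 0"
      using oproj_perp[OF S, of x0] unfolding u_def in_orthogonal_comp by blast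
    then have "inner x u = f x / f u * (norm u)\<^sup>2"
      by (simp add: inner_diff_right inner_commute power2_norm_eq_inner)
    then show ?thesis using fu \<open>u \<noteq> 0\<close> by simp
  qed
  then show ?thesis by blast
qed

lemma adjoint_inner:
  fixes A :: "'a::{real_inner,banach} \<Rightarrow> 'b::real_inner"
  assumes "bounded_linear A"
  shows "inner (A x) y = inner x (adjoint A y)"
proof -
  have "\<exists>w. \<forall>x. inner (A x) y = inner x w" for y
    by (intro riesz_representation bounded_linear_compose[OF bounded_linear_inner_left assms])
  then obtain B where "\<forall>x y. inner (A x) y = inner x (B y)" by metis
  then show ?thesis using adjoint_unique by metis
qed

lemma bounded_linear_adjoint:
  fixes A :: "'a::{real_inner,banach} \<Rightarrow> 'b::real_inner"
  assumes A: "bounded_linear A"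
  shows "bounded_linear (adjoint A)"
proof -
  obtain K where K: "\<And>x. norm (A x) \<le> norm x * K" "K \<ge> 0"
    using bounded_linear.nonneg_bounded[OF A] by blast
  show ?thesis
  proof (rule bounded_linear_intro[where K = K])
    show "adjoint A (x + y) = adjoint A x + adjoint A y" for x y
      by (rule inner_right_eqI) (simp add: inner_add adjoint_inner[OF A, symmetric])
    show "adjoint A (r *\<^sub>R x) = r *\<^sub>R adjoint A x" for r x
      by (rule inner_right_eqI) (simp add: adjoint_inner[OF A, symmetric])
    fix y
    have "(norm (adjoint A y))\<^sup>2 = inner (A (adjoint A y)) y"
      by (simp add: adjoint_inner[OF A] power2_norm_eq_inner)
    also have "\<dots> \<le> norm (A (adjoint A y)) * norm y" by (rule norm_cauchy_schwarz)
    also have "\<dots> \<le> norm (adjoint A y) * K * norm y" by (intro mult_right_mono K) auto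
    finally have "norm (adjoint A y) * norm (adjoint A y) \<le> norm (adjoint A y) * (norm y * K)"
      by (simp add: power2_eq_square mult_ac)
    then show "norm (adjoint A y) \<le> norm y * K"
      using K(2) by (cases "norm (adjoint A y) = 0") auto
  qed
qed

section \<open>Uniform boundedness and the closed graph theorem\<close>

text \<open>By Baire's theorem one of the closed sets \<open>E n\<close> contains a ball; on it all
  functionals \<open>inner x\<close> with \<open>x\<close> in \<open>X\<close> share the bound
  \<open>n\<close>, and recentring the ball at 0 costs a factor 2.\<close>

lemma weakly_bounded_imp_bounded:
  fixes X :: "'a::{real_inner,banach} set"
  assumes wb: "\<And>y. \<exists>c. \<forall>x\<in>X. \<bar>inner x y\<bar> \<le> c"
  shows "\<exists>c. \<forall>x\<in>X. norm x \<le> c"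
proof -
  define E where "E n = {y. \<forall>x\<in>X. \<bar>inner x y\<bar> \<le> real n}" for n
  have E: "closed (E n)" for n
  proof -
    have "E n = (\<Inter>x\<in>X. {y. \<bar>inner x y\<bar> \<le> real n})" by (auto simp: E_def)
    then show ?thesis by (auto intro!: closed_INT closed_Collect_le continuous_intros)
  qed
  have "y \<in> (\<Union>n. E n)" for y
  proof -
    obtain c where "\<forall>x\<in>X. \<bar>inner x y\<bar> \<le> c" using wb by blast
    moreover obtain n where "c \<le> real n" using real_arch_simple by blast
    ultimately have "y \<in> E n" by (force simp: E_def)
    then show ?thesis by blast
  qed
  then have U: "\<Union>(range E) = UNIV" by auto
  have "\<exists>n. interior (E n) \<noteq> {}"
  proof (rule ccontr)
    assume "\<not> ?thesis"
    then have "euclidean interior_of \<Union>(range E) = {}"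
      using E by (intro Baire_category_alt disjI1 completely_metrizable_space_euclidean) auto
    then show False using U by simp
  qed
  then obtain n y0 where "y0 \<in> interior (E n)" by auto
  then obtain r where r: "r > 0" "cball y0 r \<subseteq> E n" using mem_interior_cball by blast
  have "norm x \<le> 2 * real n / r" if x: "x \<in> X" for x
  proof (cases "x = 0")
    case False
    \<comment> \<open>The multiple of \<open>x\<close> of length \<open>r\<close>, on which the
      functional \<open>inner x\<close> attains its maximum \<open>r * norm x\<close> over the
      ball.\<close>
    define h where "h = (r / norm x) *\<^sub>R x"
    have "norm h = r" using False r by (simp add: h_def)
    then have "y0 + h \<in> E n" "y0 \<in> E n" using r by (auto simp: dist_norm)
    then have "\<bar>inner x (y0 + h)\<bar> \<le> real n" "\<bar>inner x y0\<bar> \<le> real n" using x by (auto simp: E_def)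
    then have "\<bar>inner x h\<bar> \<le> 2 * real n" by (simp add: inner_add_right)
    moreover have "inner x h = r * norm x"
      using False by (simp add: h_def norm_eq_square flip: power2_norm_eq_inner) (simp add: power2_eq_square)
    ultimately show ?thesis using r by (simp add: field_simps)
  qed (use r in simp)
  then show ?thesis by blast
qed

text \<open>The pairs \<open>(a, b)\<close> orthogonal to the graph of \<open>f\<close> satisfy \<open>inner (f x) b = - inner x a\<close>: they are
  the graph of minus the adjoint, which is bounded by uniform boundedness and densely defined
  because the graph of \<open>f\<close> is closed.\<close>

theorem closed_graph_theorem:
  fixes f :: "'a::{real_inner,banach} \<Rightarrow> 'b::{real_inner,banach}"
  assumes lin: "linear f" and cl: "closed {(x, y). y = f x}"
  shows "bounded_linear f"
proof -
  interpret linear f by fact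
  let ?G = "{(x, y). y = f x}"
  have G: "closed_subspace ?G" using cl by (auto simp: closed_subspace_def subspace_def add scale zero zero_prod_def)
  have perp: "(a, b) \<in> ?G\<^sup>\<bottom> \<longleftrightarrow> (\<forall>x. inner x a + inner (f x) b = 0)" for a b
    by (auto simp: in_orthogonal_comp inner_commute)
  \<comment> \<open>Bounding \<open>a\<close> in terms of \<open>b\<close> means bounding the
    adjoint. For fixed \<open>x\<close> the equation in \<open>perp\<close> gives the weak bound
    \<open>norm (f x)\<close>, uniformly over \<open>norm b \<le> 1\<close>.\<close>
  have "\<exists>c. \<forall>a\<in>{a. \<exists>b. (a, b) \<in> ?G\<^sup>\<bottom> \<and> norm b \<le> 1}. norm a \<le> c"
  proof (rule weakly_bounded_imp_bounded, intro exI ballI)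
    fix x a assume "a \<in> {a. \<exists>b. (a, b) \<in> ?G\<^sup>\<bottom> \<and> norm b \<le> 1}"
    then obtain b where b: "(a, b) \<in> ?G\<^sup>\<bottom>" "norm b \<le> 1" by auto
    then have "inner x a + inner (f x) b = 0" unfolding perp by blast
    then have "\<bar>inner a x\<bar> = \<bar>inner (f x) b\<bar>" unfolding inner_commute[of a x] by arith
    also have "\<dots> \<le> norm (f x) * norm b" by (rule Cauchy_Schwarz_ineq2)
    also have "\<dots> \<le> norm (f x)" using b(2) by (simp add: mult_left_le)
    finally show "\<bar>inner a x\<bar> \<le> norm (f x)" .
  qed
  then obtain c where c: "\<And>a b. (a, b) \<in> ?G\<^sup>\<bottom> \<Longrightarrow> norm b \<le> 1 \<Longrightarrow> norm a \<le> c" by auto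
  have c_bound: "norm a \<le> c * norm b" if ab: "(a, b) \<in> ?G\<^sup>\<bottom>" for a b
  proof (cases "b = 0")
    case True
    have "inner a a + inner (f a) b = 0" using ab unfolding perp by blast
    then show ?thesis using True by simp
  next
    case False
    have "inverse (norm b) *\<^sub>R (a, b) \<in> ?G\<^sup>\<bottom>"
      by (rule subspace_scale[OF subspace_orthogonal_comp ab])
    then have "norm (inverse (norm b) *\<^sub>R a) \<le> c" using False by (intro c) auto
    then show ?thesis using False by (simp add: field_simps)
  qed
  let ?B = "snd ` (?G\<^sup>\<bottom>)"
  have B: "subspace ?B"
    by (intro linear_subspace_image subspace_orthogonal_comp bounded_linear.linear bounded_linear_snd)
  \<comment> \<open>If \<open>v\<close> is orthogonal to all second components, then
    \<open>(0, v)\<close> is orthogonal to the complement of the closed graph. Hence it lies in the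
    graph, and \<open>v = f 0\<close>.\<close>
  have "v = 0" if v: "v \<in> ?B\<^sup>\<bottom>" for v
  proof -
    have "\<forall>y\<in>?G\<^sup>\<bottom>. inner (0, v) y = 0"
    proof
      fix y assume "y \<in> ?G\<^sup>\<bottom>"
      then have "snd y \<in> ?B" by (rule imageI)
      then have "inner v (snd y) = 0" using v in_orthogonal_comp by blast
      then show "inner (0, v) y = 0" by (simp add: inner_prod_def)
    qed
    then have "(0, v) \<in> closure ?G"
      using in_closure_subspace_iff[of ?G "(0, v)"] G by (auto simp: closed_subspace_def)
    then show "v = 0" using cl by (simp add: zero)
  qed
  then have dense: "closure ?B = UNIV" using in_closure_subspace_iff[OF B] by force
  have "norm (f x) \<le> norm x * c" for x
  proof -
    obtain b where b: "\<And>n. b n \<in> ?B" "b \<longlonglongrightarrow> f x"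
      using dense closure_sequential[of "f x" ?B] by auto
    have "inner (f x) (b n) \<le> norm x * c * norm (b n)" for n
    proof -
      obtain a where a: "(a, b n) \<in> ?G\<^sup>\<bottom>" using b(1)[of n] by auto
      then have "inner x a + inner (f x) (b n) = 0" unfolding perp by blast
      then have "inner (f x) (b n) = inner x (- a)" by simp
      also have "\<dots> \<le> norm x * norm a" using norm_cauchy_schwarz[of x "-a"] by simp
      also have "\<dots> \<le> norm x * (c * norm (b n))" by (intro mult_left_mono c_bound a) auto
      finally show ?thesis by (simp add: mult_ac)
    qed
    moreover have "(\<lambda>n. inner (f x) (b n)) \<longlonglongrightarrow> inner (f x) (f x)" by (intro tendsto_intros b)
    moreover have "(\<lambda>n. norm x * c * norm (b n)) \<longlonglongrightarrow> norm x * c * norm (f x)" by (intro tendsto_intros b)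
    ultimately have "inner (f x) (f x) \<le> norm x * c * norm (f x)"
      by (intro LIMSEQ_le) auto
    then have *: "norm (f x) * norm (f x) \<le> norm x * c * norm (f x)"
      by (simp add: power2_eq_square flip: power2_norm_eq_inner)
    have "c \<ge> 0" using c[of 0 0] by (simp add: in_orthogonal_comp zero_prod_def)
    then show ?thesis using * by (cases "f x = 0") auto
  qed
  then show ?thesis by (intro bounded_linear_intro[of f c]) (auto simp: add scale)
qed

section \<open>Operators defined by closed single-valued relations\<close>

context
  fixes \<Gamma> :: "('a::{real_inner,banach} \<times> 'b::{real_inner,banach}) set"
  assumes \<Gamma>: "closed_subspace \<Gamma>" and single: "\<And>v. (0, v) \<in> \<Gamma> \<Longrightarrow> v = 0"
    and closed_dom: "closed (fst ` \<Gamma>)"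
begin

lemma closed_subspace_fst: "closed_subspace (fst ` \<Gamma>)"
  using \<Gamma> unfolding closed_subspace_def
  by (intro conjI closed_dom linear_subspace_image bounded_linear.linear bounded_linear_fst) simp

lemma graph_unique:
  assumes "(u, v) \<in> \<Gamma>" "(u, w) \<in> \<Gamma>" shows "v = w"
proof -
  have "(u, v) - (u, w) \<in> \<Gamma>" using \<Gamma> assms by (intro subspace_diff) (simp add: closed_subspace_def)
  then show ?thesis using single[of "v - w"] by simp
qed

text \<open>Precomposing with the projection onto the closed domain makes the operator total. The
  graph of \<open>C\<close> is then the preimage of \<open>\<Gamma>\<close> under a continuous map,
  hence closed.\<close>

lemma operator_of_graph:
  obtains C where "bounded_linear C" "\<And>x. (oproj (fst ` \<Gamma>) x, C x) \<in> \<Gamma>"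
proof -
  let ?D = "fst ` \<Gamma>"
  have sub: "subspace \<Gamma>" and clo: "closed \<Gamma>" using \<Gamma> by (auto simp: closed_subspace_def)
  have "\<exists>v. (oproj ?D x, v) \<in> \<Gamma>" for x
    using oproj_in[OF closed_subspace_fst, of x] by auto
  then obtain C where C: "\<And>x. (oproj ?D x, C x) \<in> \<Gamma>" by metis
  have CI: "C x = v" if "(oproj ?D x, v) \<in> \<Gamma>" for x v using graph_unique C that by blast
  interpret p: bounded_linear "oproj ?D" by (rule bounded_linear_oproj[OF closed_subspace_fst])
  have lin: "linear C"
  proof (rule linearI)
    show "C (x + y) = C x + C y" for x y
      using subspace_add[OF sub C C, of x y] by (intro CI) (simp add: p.add)
    show "C (r *\<^sub>R x) = r *\<^sub>R C x" for r x
      using subspace_scale[OF sub C, of r x] by (intro CI) (simp add: p.scaleR)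
  qed
  have "{(x, y). y = C x} = (\<lambda>z. (oproj ?D (fst z), snd z)) -` \<Gamma>"
    using C CI by auto
  moreover have "closed ((\<lambda>z. (oproj ?D (fst z), snd z)) -` \<Gamma>)"
    by (intro closed_vimage clo continuous_on_Pair p.continuous_on continuous_on_fst
        continuous_on_snd continuous_on_id)
  ultimately have "bounded_linear C" by (intro closed_graph_theorem lin) simp
  then show thesis using C that by blast
qed

text \<open>Invariance of the domain under \<open>U\<close> and under its adjoint \<open>U'\<close>
  makes \<open>U\<close> commute with the projection onto the domain; single-valuedness does the
  rest. A separate \<open>V\<close> acts on the values because source and target may be different
  spaces, such as a direct sum and one of its summands.\<close>

lemma operator_of_graph_commute:
  assumes C: "\<And>x. (oproj (fst ` \<Gamma>) x, C x) \<in> \<Gamma>"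
    and U: "linear U" and adj: "\<And>x y. inner (U x) y = inner x (U' y)"
    and inv: "\<And>u v. (u, v) \<in> \<Gamma> \<Longrightarrow> (U u, V v) \<in> \<Gamma>"
    and inv': "\<And>u. u \<in> fst ` \<Gamma> \<Longrightarrow> U' u \<in> fst ` \<Gamma>"
  shows "C (U x) = V (C x)"
proof (rule graph_unique[OF C])
  let ?D = "fst ` \<Gamma>"
  have G: "(U (oproj ?D x), V (C x)) \<in> \<Gamma>" using inv C by blast
  have "oproj ?D (U x) = U (oproj ?D x)"
  proof (rule oproj_eqI[OF closed_subspace_fst])
    show "U (oproj ?D x) \<in> ?D" using G by force
    have "inner (U x - U (oproj ?D x)) d = 0" if "d \<in> ?D" for d
    proof -
      have "inner (x - oproj ?D x) (U' d) = 0"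
        using oproj_perp[OF closed_subspace_fst, of x] inv'[OF that] unfolding in_orthogonal_comp by blast
      then show ?thesis using adj[of "x - oproj ?D x" d] by (simp add: linear_diff[OF U])
    qed
    then show "U x - U (oproj ?D x) \<in> ?D\<^sup>\<bottom>" by (simp add: in_orthogonal_comp)
  qed
  then show "(oproj ?D (U x), V (C x)) \<in> \<Gamma>" using G by simp
qed

end

section \<open>Square roots and resolvents\<close>

text \<open>The iteration \<open>Y \<mapsto> (X + Y\<^sup>2) / 2\<close> from 0 converges in norm, because its increments are dominated
  by those of the scalar iteration \<open>y \<mapsto> (1 + y\<^sup>2) / 2\<close>, which increases and stays below 1.\<close>

lemma sqrt_one_minus:
  fixes X :: "'a::{real_inner,banach} \<Rightarrow> 'a"
  assumes blX: "bounded_linear X" and contr: "\<And>x. norm (X x) \<le> norm x"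
    and sym: "\<And>x y. inner (X x) y = inner x (X y)"
  obtains R where "bounded_linear R" "\<And>x y. inner (R x) y = inner x (R y)"
    "\<And>x. R (R x) = x - X x"
    "\<And>Z. bounded_linear Z \<Longrightarrow> Z \<circ> X = X \<circ> Z \<Longrightarrow> Z \<circ> R = R \<circ> Z"
proof -
  define T where "T = Blinfun X"
  have T: "blinfun_apply T = X" using blX by (simp add: T_def bounded_linear_Blinfun_apply)
  have nT: "norm T \<le> 1" by (rule norm_blinfun_bound) (use contr in \<open>auto simp: T\<close>)
  \<comment> \<open>A fixed point \<open>L\<close> of the iteration satisfies
    \<open>2 L = T + L L\<close>, so that \<open>id - L\<close> squares to
    \<open>id - T\<close>.\<close>
  define Y where "Y = rec_nat 0 (\<lambda>_ Z. (1/2) *\<^sub>R (T + (Z o\<^sub>L Z)))"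
  define y :: "nat \<Rightarrow> real" where "y = rec_nat 0 (\<lambda>_ z. (1/2) * (1 + z * z))"
  have Y0: "Y 0 = 0" and YS: "Y (Suc n) = (1/2) *\<^sub>R (T + (Y n o\<^sub>L Y n))" for n by (simp_all add: Y_def)
  have y0: "y 0 = 0" and yS: "y (Suc n) = (1/2) * (1 + y n * y n)" for n by (simp_all add: y_def)
  interpret bb: bounded_bilinear "(o\<^sub>L) :: ('a \<Rightarrow>\<^sub>L 'a) \<Rightarrow> _ \<Rightarrow> 'a \<Rightarrow>\<^sub>L 'a"
    by (rule bounded_bilinear_blinfun_compose)
  have y_pos: "0 \<le> y n" for n by (induction n) (simp_all add: y0 yS)
  have y_le: "y n \<le> 1" for n
  proof (induction n)
    case (Suc n)
    then have "y n * y n \<le> 1" using y_pos[of n] by (simp add: mult_le_one)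
    then show ?case by (simp add: yS)
  qed (simp add: y0)
  have y_inc: "y n \<le> y (Suc n)" for n
  proof -
    have "0 \<le> (1 - y n) * (1 - y n)" by simp
    then show ?thesis by (simp add: yS algebra_simps)
  qed
  have nY: "norm (Y n) \<le> y n" for n
  proof (induction n)
    case (Suc n)
    have "norm (Y n o\<^sub>L Y n) \<le> y n * y n"
      by (rule order_trans[OF norm_blinfun_compose]) (intro mult_mono Suc y_pos norm_ge_zero)
    then have "norm (T + (Y n o\<^sub>L Y n)) \<le> 1 + y n * y n" using nT norm_triangle_le by (metis add_mono)
    then show ?case by (simp add: yS YS)
  qed (simp add: Y0 y0)
  have comm: "Z o\<^sub>L Y n = Y n o\<^sub>L Z" if Z: "Z o\<^sub>L T = T o\<^sub>L Z" for Z n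
  proof (induction n)
    case (Suc n)
    have "blinfun_apply Z (blinfun_apply (Y n) x) = blinfun_apply (Y n) (blinfun_apply Z x)" for x
      using arg_cong[OF Suc, of "\<lambda>B. blinfun_apply B x"] by simp
    then have "Z o\<^sub>L (Y n o\<^sub>L Y n) = (Y n o\<^sub>L Y n) o\<^sub>L Z"
      by (intro blinfun_eqI) simp
    then show ?case using Z by (simp add: YS bb.scaleR_left bb.scaleR_right bb.add_left bb.add_right)
  qed (simp add: Y0)
  \<comment> \<open>Since the iterates commute, \<open>Y (Suc n)\<close> squared minus
    \<open>Y n\<close> squared factors as sum times difference, in step with the scalar
    iteration.\<close>
  have commY: "Y m o\<^sub>L Y n = Y n o\<^sub>L Y m" for m n by (metis comm)
  have step: "norm (Y (Suc n) - Y n) \<le> y (Suc n) - y n" for n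
  proof (induction n)
    case 0
    then show ?case using nT by (simp add: Y0 y0 YS yS)
  next
    case (Suc n)
    have "Y (Suc (Suc n)) - Y (Suc n) = (1/2) *\<^sub>R ((Y (Suc n) o\<^sub>L Y (Suc n)) - (Y n o\<^sub>L Y n))"
      using arg_cong2[where f = "(-)", OF YS[of "Suc n"] YS[of n]] by (simp add: scaleR_diff_right scaleR_add_right)
    also have "(Y (Suc n) o\<^sub>L Y (Suc n)) - (Y n o\<^sub>L Y n) = (Y (Suc n) + Y n) o\<^sub>L (Y (Suc n) - Y n)"
      using commY[of n "Suc n"] by (simp add: bb.add_left bb.diff_right)
    also have "norm ((1/2) *\<^sub>R \<dots>) \<le> (1/2) * (norm (Y (Suc n) + Y n) * norm (Y (Suc n) - Y n))"
      using norm_blinfun_compose[of "Y (Suc n) + Y n" "Y (Suc n) - Y n"] by simp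
    also have "\<dots> \<le> (1/2) * ((y (Suc n) + y n) * (y (Suc n) - y n))"
      using nY[of n] nY[of "Suc n"] y_pos[of n] y_pos[of "Suc n"]
      by (intro mult_left_mono mult_mono Suc) (auto intro: order_trans[OF norm_triangle_ineq])
    also have "\<dots> = y (Suc (Suc n)) - y (Suc n)"
      using arg_cong2[where f = "(-)", OF yS[of "Suc n"] yS[of n]] by (simp add: algebra_simps)
    finally show ?case .
  qed
  have diff: "norm (Y (n + k) - Y n) \<le> y (n + k) - y n" for n k
  proof (induction k)
    case (Suc k)
    have "Y (n + Suc k) - Y n = (Y (Suc (n + k)) - Y (n + k)) + (Y (n + k) - Y n)" by simp
    then show ?case using norm_triangle_le[OF add_mono[OF step[of "n + k"] Suc]] by simp
  qed simp
  have "Bseq y" by (rule BseqI'[of _ 1]) (use y_pos y_le in simp)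
  then have "convergent y" using lift_Suc_mono_le[of y, OF y_inc] by (intro Bseq_mono_convergent) auto
  then have Cy: "Cauchy y" by (rule convergent_Cauchy)
  have "Cauchy Y"
  proof (rule metric_CauchyI)
    fix e :: real assume "e > 0"
    then obtain N where N: "\<And>m n. m \<ge> N \<Longrightarrow> n \<ge> N \<Longrightarrow> dist (y m) (y n) < e"
      using metric_CauchyD[OF Cy] by blast
    have le: "dist (Y m) (Y n) < e" if "n \<ge> N" "m \<ge> n" for m n
    proof -
      obtain k where "m = n + k" using \<open>m \<ge> n\<close> le_Suc_ex by blast
      then show ?thesis using diff[of n k] N[of m n] that by (simp add: dist_norm)
    qed
    have "dist (Y m) (Y n) < e" if "n \<ge> N" "m \<ge> N" for m n
      using le[of n m] le[of m n] that by (cases "m \<ge> n") (auto simp: dist_commute)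
    then show "\<exists>M. \<forall>m\<ge>M. \<forall>n\<ge>M. dist (Y m) (Y n) < e" by blast
  qed
  then obtain L where L: "Y \<longlonglongrightarrow> L" using Cauchy_convergent convergent_def by blast
  have "(\<lambda>n. Y (Suc n)) \<longlonglongrightarrow> (1/2) *\<^sub>R (T + (L o\<^sub>L L))"
    unfolding YS by (intro tendsto_intros bb.tendsto L)
  then have Leq: "L = (1/2) *\<^sub>R (T + (L o\<^sub>L L))"
    using LIMSEQ_Suc[OF L] LIMSEQ_unique by blast
  have Lapp: "(\<lambda>n. blinfun_apply (Y n) x) \<longlonglongrightarrow> blinfun_apply L x" for x
    by (intro tendsto_intros L)
  have symY: "inner (blinfun_apply (Y n) u) v = inner u (blinfun_apply (Y n) v)" for n u v
    by (induction n arbitrary: u v)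
      (simp_all add: Y0 YS blinfun.add_left blinfun.scaleR_left inner_add T sym)
  have symL: "inner (blinfun_apply L u) v = inner u (blinfun_apply L v)" for u v
  proof -
    have "(\<lambda>n. inner (blinfun_apply (Y n) u) v) \<longlonglongrightarrow> inner (blinfun_apply L u) v"
      by (intro tendsto_intros Lapp)
    moreover have "(\<lambda>n. inner (blinfun_apply (Y n) u) v) \<longlonglongrightarrow> inner u (blinfun_apply L v)"
      unfolding symY by (intro tendsto_intros Lapp)
    ultimately show ?thesis using LIMSEQ_unique by blast
  qed
  let ?R = "\<lambda>x. x - blinfun_apply L x"
  show thesis
  proof
    show "bounded_linear ?R" by (intro bounded_linear_intros)
    show "inner (?R x) y = inner x (?R y)" for x y by (simp add: inner_diff symL)
    fix x
    have "blinfun_apply (2 *\<^sub>R L) x = blinfun_apply (2 *\<^sub>R ((1/2) *\<^sub>R (T + (L o\<^sub>L L)))) x"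
      by (rule arg_cong[OF Leq])
    then have "2 *\<^sub>R blinfun_apply L x = X x + blinfun_apply L (blinfun_apply L x)"
      by (simp add: blinfun.add_left blinfun.scaleR_left T)
    then show "?R (?R x) = x - X x" by (simp add: blinfun.diff_right scaleR_2 algebra_simps)
  next
    fix Z assume Z: "bounded_linear Z" and ZX: "Z \<circ> X = X \<circ> Z"
    have bZ: "blinfun_apply (Blinfun Z) = Z" using Z by (simp add: bounded_linear_Blinfun_apply)
    have "Blinfun Z o\<^sub>L T = T o\<^sub>L Blinfun Z"
      by (rule blinfun_eqI) (use fun_cong[OF ZX] in \<open>simp add: bZ T\<close>)
    then have c: "Blinfun Z o\<^sub>L Y n = Y n o\<^sub>L Blinfun Z" for n by (rule comm)
    have "(\<lambda>n. Blinfun Z o\<^sub>L Y n) \<longlonglongrightarrow> (Blinfun Z o\<^sub>L L)" "(\<lambda>n. Blinfun Z o\<^sub>L Y n) \<longlonglongrightarrow> (L o\<^sub>L Blinfun Z)"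
      by (intro bb.tendsto tendsto_intros L) (unfold c, intro bb.tendsto tendsto_intros L)
    then have "Blinfun Z o\<^sub>L L = L o\<^sub>L Blinfun Z" by (rule LIMSEQ_unique)
    then have "blinfun_apply (Blinfun Z o\<^sub>L L) x = blinfun_apply (L o\<^sub>L Blinfun Z) x" for x by simp
    then have "Z (blinfun_apply L x) = blinfun_apply L (Z x)" for x by (simp add: bZ)
    then show "Z \<circ> ?R = ?R \<circ> Z" using linear_diff[OF bounded_linear.linear[OF Z]] by (simp add: fun_eq_iff)
  qed
qed

section \<open>Resolvents of positive operators\<close>

text \<open>Coercivity bounds \<open>S\<close> from below, which gives injectivity and a closed
  range. A vector orthogonal to the range, tested against its own image, must vanish, so the range
  is everything.\<close>

lemma coercive_bij:
  fixes S :: "'a::{real_inner,banach} \<Rightarrow> 'a"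
  assumes S: "bounded_linear S" and c: "c > 0" and coer: "\<And>x. c * (norm x)\<^sup>2 \<le> inner (S x) x"
  shows "bij S"
proof -
  interpret bounded_linear S by fact
  have lower: "c * norm x \<le> norm (S x)" for x
  proof (cases "x = 0")
    case False
    have "c * (norm x)\<^sup>2 \<le> norm (S x) * norm x" using coer norm_cauchy_schwarz order_trans by blast
    then show ?thesis using False by (simp add: power2_eq_square)
  qed (simp add: zero)
  have "complete (range S)"
    by (rule complete_isometric_image[OF c _ S]) (use lower in \<open>auto simp: complete_UNIV\<close>)
  then have cl: "closed (range S)" by (rule complete_imp_closed)
  have sub: "subspace (range S)" by (rule linear_subspace_image[OF linear_axioms subspace_UNIV])
  have "v = 0" if "v \<in> (range S)\<^sup>\<bottom>" for v
  proof -
    have "inner (S v) v = 0" using that by (simp add: in_orthogonal_comp inner_commute)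
    then have "c * (norm v)\<^sup>2 \<le> 0" using coer[of v] by simp
    then show ?thesis using c by (simp add: mult_le_0_iff)
  qed
  then have "closure (range S) = UNIV" using in_closure_subspace_iff[OF sub] by force
  then have "surj S" using cl by simp
  moreover have "inj S"
  proof (rule injI)
    fix x y assume "S x = S y"
    then have "c * norm (x - y) \<le> 0" using lower[of "x - y"] by (simp add: diff)
    then show "x = y" using c by (simp add: mult_le_0_iff)
  qed
  ultimately show ?thesis by (simp add: bij_def)
qed

text \<open>The scaled resolvent \<open>\<epsilon> (S + \<epsilon>)\<^sup>-\<^sup>1\<close>. For positive \<open>S\<close> it decreases, as \<open>\<epsilon>\<close> tends to 0,
  to the projection onto the kernel of \<open>S\<close>.\<close>

definition rsv :: "('a::real_vector \<Rightarrow> 'a) \<Rightarrow> real \<Rightarrow> 'a \<Rightarrow> 'a" where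
  "rsv S \<epsilon> y = inv (\<lambda>x. S x + \<epsilon> *\<^sub>R x) (\<epsilon> *\<^sub>R y)"

locale positive_operator =
  fixes S :: "'a::{real_inner,banach} \<Rightarrow> 'a"
  assumes bounded: "bounded_linear S"
    and sym: "inner (S x) y = inner x (S y)"
    and pos: "0 \<le> inner (S x) x"
begin

sublocale bounded_linear S by (rule bounded)

lemma shift_bij:
  assumes "\<epsilon> > 0" shows "bij (\<lambda>x. S x + \<epsilon> *\<^sub>R x)"
proof (rule coercive_bij[OF _ assms])
  show "bounded_linear (\<lambda>x. S x + \<epsilon> *\<^sub>R x)" by (intro bounded_linear_intros bounded_linear_axioms)
  show "\<epsilon> * (norm x)\<^sup>2 \<le> inner (S x + \<epsilon> *\<^sub>R x) x" for x
    using pos[of x] by (simp add: inner_add_left power2_norm_eq_inner)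
qed

context
  fixes \<epsilon> :: real
  assumes \<epsilon>: "\<epsilon> > 0"
begin

lemma rsv_eq: "S (rsv S \<epsilon> y) + \<epsilon> *\<^sub>R rsv S \<epsilon> y = \<epsilon> *\<^sub>R y"
  using surj_f_inv_f[OF bij_is_surj[OF shift_bij[OF \<epsilon>]]] by (simp add: rsv_def)

lemma rsv_eqI:
  assumes "S x + \<epsilon> *\<^sub>R x = \<epsilon> *\<^sub>R y"
  shows "rsv S \<epsilon> y = x"
  unfolding rsv_def assms[symmetric] using inv_f_f[OF bij_is_inj[OF shift_bij[OF \<epsilon>]], of x] by simp

lemma rsv_linear: "linear (rsv S \<epsilon>)"
proof (rule linearI)
  fix x y and r :: real
  have "\<epsilon> *\<^sub>R x + \<epsilon> *\<^sub>R y = (S (rsv S \<epsilon> x) + \<epsilon> *\<^sub>R rsv S \<epsilon> x) + (S (rsv S \<epsilon> y) + \<epsilon> *\<^sub>R rsv S \<epsilon> y)"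
    by (simp only: rsv_eq)
  then show "rsv S \<epsilon> (x + y) = rsv S \<epsilon> x + rsv S \<epsilon> y"
    by (intro rsv_eqI) (simp add: add algebra_simps)
  have "r *\<^sub>R \<epsilon> *\<^sub>R x = r *\<^sub>R (S (rsv S \<epsilon> x) + \<epsilon> *\<^sub>R rsv S \<epsilon> x)"
    by (simp only: rsv_eq)
  then show "rsv S \<epsilon> (r *\<^sub>R x) = r *\<^sub>R rsv S \<epsilon> x"
    by (intro rsv_eqI) (simp add: scaleR algebra_simps)
qed

lemma rsv_commute:
  assumes "linear Z" "Z \<circ> S = S \<circ> Z"
  shows "Z \<circ> rsv S \<epsilon> = rsv S \<epsilon> \<circ> Z"
proof
  fix x
  have "Z (S (rsv S \<epsilon> x) + \<epsilon> *\<^sub>R rsv S \<epsilon> x) = Z (\<epsilon> *\<^sub>R x)" by (simp only: rsv_eq)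
  then have "S (Z (rsv S \<epsilon> x)) + \<epsilon> *\<^sub>R Z (rsv S \<epsilon> x) = \<epsilon> *\<^sub>R Z x"
    using fun_cong[OF assms(2)] by (simp add: linear_add[OF assms(1)] linear_scale[OF assms(1)])
  then show "(Z \<circ> rsv S \<epsilon>) x = (rsv S \<epsilon> \<circ> Z) x" using rsv_eqI by simp
qed

lemma rsv_sym: "inner (rsv S \<epsilon> x) y = inner x (rsv S \<epsilon> y)"
proof -
  let ?u = "rsv S \<epsilon> x" and ?v = "rsv S \<epsilon> y"
  have "\<epsilon> * inner ?u y = inner ?u (S ?v + \<epsilon> *\<^sub>R ?v)" by (simp only: rsv_eq inner_scaleR_right)
  also have "\<dots> = inner (S ?u + \<epsilon> *\<^sub>R ?u) ?v" by (simp add: inner_add sym)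
  also have "\<dots> = \<epsilon> * inner x ?v" by (simp only: rsv_eq inner_scaleR_left)
  finally show ?thesis using \<epsilon> by simp
qed

text \<open>As an operator inequality this says that the square of the resolvent lies below the
  resolvent. Positivity and contractivity both follow from it.\<close>

lemma rsv_pos: "(norm (rsv S \<epsilon> x))\<^sup>2 \<le> inner (rsv S \<epsilon> x) x"
proof -
  let ?u = "rsv S \<epsilon> x"
  have "\<epsilon> * inner ?u x = inner ?u (S ?u + \<epsilon> *\<^sub>R ?u)" by (simp only: rsv_eq inner_scaleR_right)
  also have "\<dots> = inner (S ?u) ?u + \<epsilon> * (norm ?u)\<^sup>2"
    by (simp add: inner_add sym power2_norm_eq_inner)
  finally have "\<epsilon> * (norm ?u)\<^sup>2 \<le> \<epsilon> * inner ?u x" using pos[of ?u] by simp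
  then show ?thesis using \<epsilon> by simp
qed

lemma norm_rsv_le: "norm (rsv S \<epsilon> x) \<le> norm x"
proof (cases "rsv S \<epsilon> x = 0")
  case False
  have "(norm (rsv S \<epsilon> x))\<^sup>2 \<le> norm (rsv S \<epsilon> x) * norm x"
    using rsv_pos norm_cauchy_schwarz order_trans by blast
  then show ?thesis using False by (simp add: power2_eq_square)
qed simp

lemma rsv_bounded_linear: "bounded_linear (rsv S \<epsilon>)"
  using norm_rsv_le
  by (intro bounded_linear_intro[where K = 1]) (simp_all add: linear_add[OF rsv_linear] linear_scale[OF rsv_linear])

text \<open>Write \<open>S\<close> as \<open>(S + \<epsilon>) - \<epsilon>\<close>. The factor
  \<open>\<epsilon>\<close> gained on the range of \<open>S\<close> is what makes the resolvents
  tend to 0 there.\<close>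

lemma rsv_range: "rsv S \<epsilon> (S w) = \<epsilon> *\<^sub>R (w - rsv S \<epsilon> w)"
proof (rule rsv_eqI)
  let ?r = "rsv S \<epsilon> w"
  have "S (\<epsilon> *\<^sub>R (w - ?r)) + \<epsilon> *\<^sub>R \<epsilon> *\<^sub>R (w - ?r) = \<epsilon> *\<^sub>R (S w + \<epsilon> *\<^sub>R w - (S ?r + \<epsilon> *\<^sub>R ?r))"
    by (simp add: scaleR diff algebra_simps)
  then show "S (\<epsilon> *\<^sub>R (w - ?r)) + \<epsilon> *\<^sub>R \<epsilon> *\<^sub>R (w - ?r) = \<epsilon> *\<^sub>R S w" by (simp add: rsv_eq)
qed

lemma rsv_kernel: "S x = 0 \<Longrightarrow> rsv S \<epsilon> x = x"
  by (rule rsv_eqI) simp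

end

text \<open>With \<open>x = (S + \<epsilon>) (S + \<delta>) y\<close> both resolvents at
  \<open>x\<close> are polynomials in \<open>S\<close> applied to \<open>y\<close>, and the
  difference of the two forms is \<open>\<epsilon> - \<delta>\<close> times a sum of nonnegative
  terms.\<close>

lemma rsv_mono:
  assumes "0 < \<delta>" "\<delta> \<le> \<epsilon>"
  shows "inner (rsv S \<delta> x) x \<le> inner (rsv S \<epsilon> x) x"
proof -
  have "\<epsilon> > 0" using assms by simp
  obtain z where "x = S z + \<epsilon> *\<^sub>R z" using bij_is_surj[OF shift_bij[OF \<open>\<epsilon> > 0\<close>]] by (rule surjE)
  moreover obtain y where "z = S y + \<delta> *\<^sub>R y" using bij_is_surj[OF shift_bij[OF assms(1)]] by (rule surjE)
  ultimately have x: "x = S (S y) + (\<epsilon> + \<delta>) *\<^sub>R S y + (\<epsilon> * \<delta>) *\<^sub>R y"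
    by (simp add: add scaleR algebra_simps)
  have e: "rsv S \<epsilon> x = \<epsilon> *\<^sub>R (S y + \<delta> *\<^sub>R y)" and d: "rsv S \<delta> x = \<delta> *\<^sub>R (S y + \<epsilon> *\<^sub>R y)"
    by (rule rsv_eqI[OF \<open>\<epsilon> > 0\<close>] rsv_eqI[OF assms(1)], simp add: x add scaleR algebra_simps)+
  have "rsv S \<epsilon> x - rsv S \<delta> x = (\<epsilon> - \<delta>) *\<^sub>R S y" by (simp add: e d algebra_simps)
  then have "inner (rsv S \<epsilon> x) x - inner (rsv S \<delta> x) x = (\<epsilon> - \<delta>) * inner (S y) x"
    by (simp flip: inner_diff_left)
  also have "inner (S y) x = inner (S (S y)) (S y) + (\<epsilon> + \<delta>) * inner (S y) (S y) + \<epsilon> * \<delta> * inner (S y) y"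
    by (simp add: x inner_add_right inner_commute)
  also have "(\<epsilon> - \<delta>) * \<dots> \<ge> 0"
    using assms pos[of "S y"] pos[of y] by (intro mult_nonneg_nonneg add_nonneg_nonneg) auto
  finally show ?thesis by simp
qed

lemma kernel_closed_subspace: "closed_subspace {x. S x = 0}"
  by (auto simp: closed_subspace_def subspace_def add scaleR zero
      intro!: closed_Collect_eq continuous_on_const linear_continuous_on bounded_linear_axioms)

text \<open>The resolvent fixes the kernel and is symmetric, so its form has no cross terms between
  the kernel and the complement. The complement contributes a nonnegative term.\<close>

lemma oproj_kernel_le_rsv:
  assumes "\<epsilon> > 0"
  shows "inner (oproj {x. S x = 0} x) x \<le> inner (rsv S \<epsilon> x) x"
proof -
  let ?p = "oproj {x. S x = 0} x"
  let ?z = "x - ?p"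
  note K = kernel_closed_subspace
  have p: "rsv S \<epsilon> ?p = ?p" using oproj_in[OF K, of x] by (intro rsv_kernel[OF assms]) simp
  have z: "inner ?z ?p = 0" using oproj_in[OF K, of x] oproj_perp[OF K, of x] unfolding in_orthogonal_comp by blast
  have "rsv S \<epsilon> x = ?p + rsv S \<epsilon> ?z" using p linear_diff[OF rsv_linear[OF assms]] by simp
  then have "inner (rsv S \<epsilon> x) x = inner ?p x + inner (rsv S \<epsilon> ?z) (?z + ?p)" by (simp add: inner_add_left)
  also have "\<dots> = inner ?p x + inner (rsv S \<epsilon> ?z) ?z"
    by (simp only: inner_add_right rsv_sym[OF assms, of _ ?p] p z)
  finally show ?thesis using rsv_pos[OF assms, of ?z] zero_le_power2 order_trans by (simp, blast)
qed

text \<open>The range of the symmetric \<open>S\<close> is dense in the complement of its kernel. So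
  the part of \<open>x\<close> off the kernel is close to some \<open>S w\<close>, where the
  resolvent is of order \<open>\<epsilon>\<close>; contractivity controls the approximation error
  for every \<open>\<epsilon>\<close>.\<close>

lemma rsv_tendsto_oproj_kernel:
  assumes "e > 0"
  shows "\<exists>\<epsilon>>0. norm (rsv S \<epsilon> x - oproj {x. S x = 0} x) < e"
proof -
  let ?p = "oproj {x. S x = 0} x"
  let ?z = "x - ?p"
  note K = kernel_closed_subspace
  have sub: "subspace (range S)" by (rule linear_subspace_image[OF linear_axioms subspace_UNIV])
  have "(range S)\<^sup>\<bottom> \<subseteq> {x. S x = 0}"
  proof
    fix v assume "v \<in> (range S)\<^sup>\<bottom>"
    then have "inner (S v) (S v) = 0" by (simp add: in_orthogonal_comp sym)
    then show "v \<in> {x. S x = 0}" by simp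
  qed
  then have "?z \<in> closure (range S)"
    unfolding in_closure_subspace_iff[OF sub] using oproj_perp[OF K, of x] by (auto simp: in_orthogonal_comp)
  then have "\<exists>y\<in>range S. dist y ?z < e / 2"
    using half_gt_zero[OF assms] unfolding closure_approachable by blast
  then obtain w where w: "norm (?z - S w) < e / 2"
    by (auto simp: dist_norm norm_minus_commute)
  \<comment> \<open>Chosen so that the contribution of \<open>S w\<close>, at most
    \<open>2 * \<epsilon> * norm w\<close>, stays below \<open>e / 2\<close>; the summand 1 guards
    against \<open>w = 0\<close>.\<close>
  define \<epsilon> where "\<epsilon> = e / (4 * (norm w + 1))"
  have \<epsilon>: "\<epsilon> > 0" using assms by (simp add: \<epsilon>_def add_nonneg_pos)
  interpret r: linear "rsv S \<epsilon>" by (rule rsv_linear[OF \<epsilon>])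
  have "rsv S \<epsilon> ?p = ?p" using oproj_in[OF K, of x] by (intro rsv_kernel[OF \<epsilon>]) simp
  then have "rsv S \<epsilon> x - ?p = rsv S \<epsilon> (?z - S w) + rsv S \<epsilon> (S w)" by (simp add: r.diff)
  moreover have "norm (rsv S \<epsilon> (S w)) \<le> e / 2"
  proof -
    have "norm (w - rsv S \<epsilon> w) \<le> 2 * norm w"
      using norm_triangle_ineq4[of w "rsv S \<epsilon> w"] norm_rsv_le[OF \<epsilon>, of w] by simp
    then have "norm (rsv S \<epsilon> (S w)) \<le> \<epsilon> * (2 * norm w)"
      using \<epsilon> by (simp add: rsv_range[OF \<epsilon>])
    also have "\<dots> \<le> \<epsilon> * (2 * (norm w + 1))" using \<epsilon> by simp
    also have "\<dots> = e / 2" by (simp add: \<epsilon>_def field_simps add_nonneg_eq_0_iff)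
    finally show ?thesis .
  qed
  ultimately have "norm (rsv S \<epsilon> x - ?p) < e"
    using w norm_rsv_le[OF \<epsilon>, of "?z - S w"] norm_triangle_ineq[of "rsv S \<epsilon> (?z - S w)" "rsv S \<epsilon> (S w)"] by simp
  then show ?thesis using \<epsilon> by blast
qed

end

section \<open>Complex Hilbert spaces\<close>

lemma cinner_scaleC_right: "cinner x (c *\<^sub>C y) = cnj c * cinner x y"
  by (metis cinner_commute cinner_scaleC_left complex_cnj_mult)

text \<open>The imaginary part is the real inner product after rotation by \<open>- \<i>\<close>, so
  real identities valid for all vectors yield complex ones.\<close>

lemma cinner_conv_inner:
  "cinner x y = complex_of_real (inner x y) + \<i> * complex_of_real (inner ((- \<i>) *\<^sub>C x) y)"
  by (simp add: complex_eq_iff inner_eq_Re_cinner cinner_scaleC_left)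

lemma inner_scaleC_left: "inner (c *\<^sub>C x) y = inner x (cnj c *\<^sub>C y)"
  by (simp add: inner_eq_Re_cinner cinner_scaleC_left cinner_scaleC_right)

lemma scaleC_scaleR: "c *\<^sub>C (r *\<^sub>R x) = r *\<^sub>R (c *\<^sub>C x)"
  by (simp add: scaleR_scaleC scaleC_scaleC mult.commute)

lemma scaleC_one [simp]: "1 *\<^sub>C x = (x::'a::complex_hilbert)"
  using scaleR_scaleC[of 1 x] by simp

lemma norm_scaleC: "norm (c *\<^sub>C x) = cmod c * norm x"
proof -
  have "inner (c *\<^sub>C x) (c *\<^sub>C x) = inner x ((cnj c * c) *\<^sub>C x)"
    by (simp add: inner_scaleC_left scaleC_scaleC)
  also have "cnj c * c = complex_of_real ((cmod c)\<^sup>2)"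
    by (metis complex_norm_square mult.commute)
  also have "inner x (complex_of_real ((cmod c)\<^sup>2) *\<^sub>C x) = (cmod c * norm x)\<^sup>2"
    by (simp only: scaleR_scaleC[symmetric] inner_scaleR_right power_mult_distrib power2_norm_eq_inner)
  finally show ?thesis by (simp add: norm_eq_sqrt_inner)
qed

lemma bounded_op_scaleC: "bounded_op (\<lambda>x. c *\<^sub>C x)"
  unfolding bounded_op_def
proof
  show "bounded_linear (\<lambda>x. c *\<^sub>C x :: 'a)"
    by (rule bounded_linear_intro[where K = "cmod c"]) (simp_all add: scaleC_add_right scaleC_scaleR norm_scaleC mult.commute)
  show "\<forall>d x. c *\<^sub>C d *\<^sub>C x = d *\<^sub>C c *\<^sub>C (x::'a)" by (simp add: scaleC_scaleC mult.commute)
qed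

lemma bounded_op_bounded_linear: "bounded_op A \<Longrightarrow> bounded_linear A"
  by (simp add: bounded_op_def)

lemma bounded_op_comp: "bounded_op A \<Longrightarrow> bounded_op B \<Longrightarrow> bounded_op (A \<circ> B)"
  by (simp add: bounded_op_def bounded_linear_compose comp_def)

lemma bounded_op_add: "bounded_op A \<Longrightarrow> bounded_op B \<Longrightarrow> bounded_op (\<lambda>x. A x + B x)"
  by (simp add: bounded_op_def bounded_linear_add scaleC_add_right)

text \<open>Because \<open>A\<close> commutes with the rotation by \<open>- \<i>\<close>, the real
  adjoint identity at rotated vectors supplies the imaginary part. Complex adjoints can thus be
  computed with the real inner product alone.\<close>

lemma cadjoint_unique:
  fixes A :: "'a::complex_hilbert \<Rightarrow> 'a"
  assumes A: "bounded_op A" and adj: "\<And>x y. inner (A x) y = inner x (B y)"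
  shows "cadjoint A = B"
  unfolding cadjoint_def
proof (rule the_equality)
  have c: "(- \<i>) *\<^sub>C A x = A ((- \<i>) *\<^sub>C x)" for x using A by (simp add: bounded_op_def)
  have "cinner (A x) y = cinner x (B y)" for x y
    unfolding cinner_conv_inner c adj ..
  then show "\<forall>x y. cinner (A x) y = cinner x (B y)" by blast
  fix C assume C: "\<forall>x y. cinner (A x) y = cinner x (C y)"
  show "C = B"
  proof
    fix y
    have "inner x (C y) = inner x (B y)" for x
      using C adj[of x y] by (simp add: inner_eq_Re_cinner)
    then show "C y = B y" by (rule inner_right_eqI)
  qed
qed

context
  fixes A :: "'a::complex_hilbert \<Rightarrow> 'a"
  assumes A: "bounded_op A"
begin

lemma cadjoint_eq_adjoint: "cadjoint A = adjoint A"
  by (rule cadjoint_unique[OF A adjoint_inner[OF bounded_op_bounded_linear[OF A]]])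

lemma cadjoint_inner: "inner (A x) y = inner x (cadjoint A y)"
  unfolding cadjoint_eq_adjoint by (rule adjoint_inner[OF bounded_op_bounded_linear[OF A]])

lemma cadjoint_inner': "inner (cadjoint A x) y = inner x (A y)"
  using cadjoint_inner[of y x] by (simp add: inner_commute)

lemma bounded_op_cadjoint: "bounded_op (cadjoint A)"
  unfolding bounded_op_def
proof (intro conjI allI)
  show "bounded_linear (cadjoint A)"
    unfolding cadjoint_eq_adjoint by (rule bounded_linear_adjoint[OF bounded_op_bounded_linear[OF A]])
  fix c y
  have "inner (cadjoint A (c *\<^sub>C y)) x = inner (c *\<^sub>C cadjoint A y) x" for x
    using A by (simp add: cadjoint_inner' inner_scaleC_left bounded_op_def)
  then show "cadjoint A (c *\<^sub>C y) = c *\<^sub>C cadjoint A y" by (rule inner_left_eqI)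
qed

lemma cadjoint_cadjoint: "cadjoint (cadjoint A) = A"
  by (rule cadjoint_unique[OF bounded_op_cadjoint cadjoint_inner'])

end

lemma closed_subspace_null_space:
  assumes "bounded_op A"
  shows "closed_subspace (null_space A)"
proof -
  interpret bounded_linear A using assms by (rule bounded_op_bounded_linear)
  show ?thesis
    by (auto simp: closed_subspace_def null_space_def subspace_def add scaleR zero
      intro!: closed_Collect_eq continuous_on_const linear_continuous_on bounded_linear_axioms)
qed

lemma subspace_range: "bounded_op A \<Longrightarrow> subspace (range A)"
  by (metis bounded_linear.linear bounded_op_bounded_linear linear_subspace_image subspace_UNIV)

lemma orthogonal_comp_range:
  assumes "bounded_op A"
  shows "(range A)\<^sup>\<bottom> = null_space (cadjoint A)"
proof -
  have "x \<in> (range A)\<^sup>\<bottom> \<longleftrightarrow> (\<forall>y. inner (cadjoint A x) y = 0)" for x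
    by (simp add: in_orthogonal_comp cadjoint_inner'[OF assms])
  moreover have "(\<forall>y. inner v y = 0) \<longleftrightarrow> v = 0" for v :: 'a by (metis inner_eq_zero_iff inner_zero_left)
  ultimately show ?thesis by (auto simp: null_space_def)
qed

lemma closed_orthogonal_comp: "closed (W\<^sup>\<bottom> :: 'a::real_inner set)"
proof -
  have "W\<^sup>\<bottom> = (\<Inter>w\<in>W. {x. inner x w = 0})" by (auto simp: in_orthogonal_comp)
  then show ?thesis by (auto intro!: closed_INT closed_Collect_eq continuous_intros)
qed

text \<open>\<open>inner x (cadjoint A (A x))\<close> is the square of \<open>norm (A x)\<close>.
  This lets the positive operator \<open>cadjoint A \<circ> A\<close> stand in for \<open>A\<close>
  when its kernel is approximated by resolvents.\<close>

lemma null_space_cadjoint_comp: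
  assumes "bounded_op A"
  shows "null_space (cadjoint A \<circ> A) = null_space A"
proof -
  have "cadjoint A 0 = 0"
    by (rule linear_0[OF bounded_linear.linear[OF bounded_op_bounded_linear[OF bounded_op_cadjoint[OF assms]]]])
  moreover have "A x = 0" if "cadjoint A (A x) = 0" for x
    using cadjoint_inner[OF assms, of x "A x"] that by simp
  ultimately show ?thesis by (auto simp: null_space_def)
qed

lemma positive_operator_cadjoint_comp:
  assumes "bounded_op A"
  shows "positive_operator (cadjoint A \<circ> A)"
proof (rule positive_operator.intro)
  show "bounded_linear (cadjoint A \<circ> A)"
    using assms by (intro bounded_op_bounded_linear bounded_op_comp bounded_op_cadjoint)
  show "inner ((cadjoint A \<circ> A) x) y = inner x ((cadjoint A \<circ> A) y)" for x y
    by (simp add: cadjoint_inner[OF assms] cadjoint_inner'[OF assms])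
  show "0 \<le> inner ((cadjoint A \<circ> A) x) x" for x
    by (simp add: cadjoint_inner'[OF assms])
qed

section \<open>Commutants and the operator order\<close>

lemma commutantI: "bounded_op T \<Longrightarrow> (\<And>A x. A \<in> S \<Longrightarrow> T (A x) = A (T x)) \<Longrightarrow> T \<in> commutant S"
  by (auto simp: commutant_def)

lemma commutant_bounded_op: "T \<in> commutant S \<Longrightarrow> bounded_op T"
  by (simp add: commutant_def)

lemma commutant_commute: "T \<in> commutant S \<Longrightarrow> A \<in> S \<Longrightarrow> T (A x) = A (T x)"
  using comp_eq_dest[of T A A T x] by (simp add: commutant_def)

lemma commutant_cadjoint:
  assumes S: "\<And>A. A \<in> S \<Longrightarrow> bounded_op A \<and> cadjoint A \<in> S" and T: "T \<in> commutant S"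
  shows "cadjoint T \<in> commutant S"
proof (rule commutantI)
  note bT = commutant_bounded_op[OF T]
  show "bounded_op (cadjoint T)" by (rule bounded_op_cadjoint[OF bT])
  fix A x assume A: "A \<in> S"
  have "inner (cadjoint T (A x)) y = inner (A (cadjoint T x)) y" for y
    using S[OF A] commutant_commute[OF T, of "cadjoint A"]
    by (simp add: cadjoint_inner'[OF bT] cadjoint_inner)
  then show "cadjoint T (A x) = A (cadjoint T x)" by (rule inner_left_eqI)
qed

text \<open>\<open>op_le\<close> asks for a real and nonnegative complex form. For self-adjoint
  operators the form is automatically real, which leaves an inequality of real quadratic
  forms.\<close>

lemma op_le_iff:
  fixes A B :: "'a::complex_hilbert \<Rightarrow> 'a"
  assumes "bounded_op A" "bounded_op B" "cadjoint A = A" "cadjoint B = B"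
  shows "op_le A B \<longleftrightarrow> (\<forall>x. inner (A x) x \<le> inner (B x) x)"
proof -
  have "Im (cinner (B x - A x) x) = 0" for x
  proof -
    have c: "C ((- \<i>) *\<^sub>C x) = (- \<i>) *\<^sub>C C x" if "bounded_op C" for C :: "'a \<Rightarrow> 'a"
      using that unfolding bounded_op_def by blast
    have *: "inner ((- \<i>) *\<^sub>C C x) x = 0" if C: "bounded_op C" "cadjoint C = C" for C :: "'a \<Rightarrow> 'a"
    proof -
      have "inner ((- \<i>) *\<^sub>C C x) x = inner ((- \<i>) *\<^sub>C x) (C x)"
        using cadjoint_inner[OF C(1), of "(- \<i>) *\<^sub>C x" x] c[OF C(1)] C(2) by simp
      also have "\<dots> = - inner ((- \<i>) *\<^sub>C C x) x"
        by (simp add: inner_eq_Re_cinner cinner_scaleC_left cinner_commute[of x "C x"])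
      finally show ?thesis by simp
    qed
    have "(- \<i>) *\<^sub>C (B x - A x) = (- \<i>) *\<^sub>C B x - (- \<i>) *\<^sub>C A x"
      by (rule linear_diff[OF bounded_linear.linear[OF bounded_op_bounded_linear[OF bounded_op_scaleC]]])
    then show ?thesis using * assms by (simp add: cinner_conv_inner inner_diff_left)
  qed
  moreover have "Re (cinner (B x - A x) x) = inner (B x) x - inner (A x) x" for x
    by (simp add: inner_eq_Re_cinner[symmetric] inner_diff_left)
  ultimately show ?thesis by (simp add: op_le_def complex_nonneg_Reals_iff)
qed

text \<open>Polarization: expanding the forms at \<open>x + y\<close> isolates the mixed terms,
  which agree by symmetry.\<close>

lemma selfadjoint_eqI:
  fixes A B :: "'a::complex_hilbert \<Rightarrow> 'a"
  assumes bd: "bounded_op A" "bounded_op B" and sa: "cadjoint A = A" "cadjoint B = B"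
    and eq: "\<And>x. inner (A x) x = inner (B x) x"
  shows "A = B"
proof
  fix x
  interpret A: bounded_linear A by (rule bounded_op_bounded_linear[OF bd(1)])
  interpret B: bounded_linear B by (rule bounded_op_bounded_linear[OF bd(2)])
  have sym: "inner (A y) x = inner y (A x)" "inner (B y) x = inner y (B x)" for y
    using cadjoint_inner[OF bd(1), of y x] cadjoint_inner[OF bd(2), of y x] sa by simp_all
  have "inner (A x) y = inner (B x) y" for y
    using eq[of "x + y"] eq[of x] eq[of y] sym[of y]
    by (simp add: A.add B.add inner_add inner_commute)
  then show "A x = B x" by (rule inner_left_eqI)
qed

text \<open>Normality says only that an image is some supremum in \<open>N\<close>; antisymmetry
  identifies it with the supremum computed there directly.\<close>

lemma is_op_sup_unique:
  assumes bd: "\<And>A. A \<in> M \<Longrightarrow> bounded_op A" and A: "is_op_sup M D A" and B: "is_op_sup M D B"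
  shows "A = B"
proof (rule selfadjoint_eqI)
  show *: "bounded_op A" "bounded_op B" "cadjoint A = A" "cadjoint B = B"
    using A B bd by (auto simp: is_op_sup_def selfadjoint_part_def)
  have "op_le A B" "op_le B A" using A B by (auto simp: is_op_sup_def)
  then show "inner (A x) x = inner (B x) x" for x
    using * by (simp add: op_le_iff order_antisym)
qed

section \<open>Von Neumann algebras\<close>

definition null_proj :: "('a::complex_hilbert \<Rightarrow> 'a) \<Rightarrow> 'a \<Rightarrow> 'a" where
  "null_proj A = oproj (null_space A)"

lemma null_proj_fix: "bounded_op A \<Longrightarrow> A x = 0 \<Longrightarrow> null_proj A x = x"
  unfolding null_proj_def by (rule oproj_fix) (simp_all add: closed_subspace_null_space, simp add: null_space_def)

lemma null_proj_null: "bounded_op A \<Longrightarrow> A (null_proj A x) = 0"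
  unfolding null_proj_def using oproj_in[OF closed_subspace_null_space, of A x] by (simp add: null_space_def)

lemma null_proj_perp: "bounded_op A \<Longrightarrow> x - null_proj A x \<in> (null_space A)\<^sup>\<bottom>"
  unfolding null_proj_def by (rule oproj_perp[OF closed_subspace_null_space])

lemma null_proj_comp: "bounded_op A \<Longrightarrow> A (x - null_proj A x) = A x"
  using linear_diff[OF bounded_linear.linear[OF bounded_op_bounded_linear]] null_proj_null by fastforce

locale von_neumann =
  fixes M :: "('a::complex_hilbert \<Rightarrow> 'a) set"
  assumes vna: "von_neumann_algebra M"
begin

lemma bicommutant: "commutant (commutant M) = M"
  using vna by (simp add: von_neumann_algebra_def)

lemma bd: "A \<in> M \<Longrightarrow> bounded_op A"
  using bicommutant commutant_bounded_op by blast

lemma bl: "A \<in> M \<Longrightarrow> bounded_linear A"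
  using bd bounded_op_bounded_linear by blast

lemma adj: "A \<in> M \<Longrightarrow> cadjoint A \<in> M"
  using vna by (simp add: von_neumann_algebra_def)

lemma commutant_adj: "U \<in> commutant M \<Longrightarrow> cadjoint U \<in> commutant M"
  by (rule commutant_cadjoint) (auto intro: bd adj)

lemma commute: "A \<in> M \<Longrightarrow> U \<in> commutant M \<Longrightarrow> A (U x) = U (A x)"
  using commutant_commute by metis

lemma scaleC_commutant: "(\<lambda>x. c *\<^sub>C x) \<in> commutant M"
  using bd by (intro commutantI bounded_op_scaleC) (auto simp: bounded_op_def)

text \<open>Complex linearity need not be checked because the scalars belong to the commutant.\<close>

lemma memI:
  assumes T: "bounded_linear T" and comm: "\<And>U x. U \<in> commutant M \<Longrightarrow> T (U x) = U (T x)"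
  shows "T \<in> M"
proof -
  have "bounded_op T" using T comm[OF scaleC_commutant] by (simp add: bounded_op_def)
  then have "T \<in> commutant (commutant M)" using comm by (rule commutantI)
  then show ?thesis by (simp add: bicommutant)
qed

lemma commutant_linear: "U \<in> commutant M \<Longrightarrow> linear U"
  using commutant_bounded_op bounded_op_bounded_linear bounded_linear.linear by blast

lemma id_mem: "id \<in> M"
  by (rule memI) (simp_all add: id_def bounded_linear_ident)

lemma comp_mem: "A \<in> M \<Longrightarrow> B \<in> M \<Longrightarrow> A \<circ> B \<in> M"
  by (rule memI) (use bl in \<open>auto simp: commute comp_def intro: bounded_linear_compose\<close>)

lemma diff_mem: "A \<in> M \<Longrightarrow> B \<in> M \<Longrightarrow> (\<lambda>x. A x - B x) \<in> M"
  by (rule memI) (use bl in \<open>auto simp: commute linear_diff[OF commutant_linear] intro: bounded_linear_sub\<close>)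

lemma scaleC_mem: "A \<in> M \<Longrightarrow> (\<lambda>x. c *\<^sub>C A x) \<in> M"
  by (rule memI)
    (use bl in \<open>auto simp: commute bounded_op_def dest: commutant_bounded_op
       intro: bounded_linear_compose bounded_op_bounded_linear[OF bounded_op_scaleC]\<close>)

definition invariant :: "'a set \<Rightarrow> bool" where
  "invariant S \<longleftrightarrow> (\<forall>U\<in>commutant M. \<forall>x\<in>S. U x \<in> S)"

lemma invariantD: "invariant S \<Longrightarrow> U \<in> commutant M \<Longrightarrow> x \<in> S \<Longrightarrow> U x \<in> S"
  by (simp add: invariant_def)

lemma invariant_orthogonal_comp: "invariant S \<Longrightarrow> invariant (S\<^sup>\<bottom>)"
  unfolding invariant_def
proof (intro ballI)
  fix U x assume S: "\<forall>U\<in>commutant M. \<forall>x\<in>S. U x \<in> S" and U: "U \<in> commutant M" and x: "x \<in> S\<^sup>\<bottom>"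
  have "inner (U x) s = 0" if "s \<in> S" for s
    using x S commutant_adj[OF U] that
    unfolding cadjoint_inner[OF commutant_bounded_op[OF U]] in_orthogonal_comp by blast
  then show "U x \<in> S\<^sup>\<bottom>" by (simp add: in_orthogonal_comp)
qed

text \<open>The commutant is closed under adjoints, so it leaves the orthogonal complement invariant
  together with \<open>S\<close>. Hence its elements commute with the projection.\<close>

lemma oproj_mem:
  assumes S: "closed_subspace S" and inv: "invariant S"
  shows "oproj S \<in> M"
proof (rule memI[OF bounded_linear_oproj[OF S]], rule oproj_eqI[OF S])
  fix U x assume U: "U \<in> commutant M"
  show "U (oproj S x) \<in> S" by (rule invariantD[OF inv U oproj_in[OF S]])
  show "U x - U (oproj S x) \<in> S\<^sup>\<bottom>"
    using invariantD[OF invariant_orthogonal_comp[OF inv] U oproj_perp[OF S, of x]]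
    by (simp add: linear_diff[OF commutant_linear[OF U]])
qed

lemma invariant_null_space: "A \<in> M \<Longrightarrow> invariant (null_space A)"
  using commute[of A] by (simp add: invariant_def null_space_def linear_0[OF commutant_linear])

lemma null_proj_mem: "A \<in> M \<Longrightarrow> null_proj A \<in> M"
  unfolding null_proj_def by (intro oproj_mem closed_subspace_null_space bd invariant_null_space)

text \<open>Stated for arbitrary sets of pairs, so that it also covers closures of graphs and
  solution sets of equations.\<close>

definition graph_invariant :: "('a \<times> 'a) set \<Rightarrow> bool" where
  "graph_invariant \<Gamma> \<longleftrightarrow> (\<forall>U\<in>commutant M. map_prod U U ` \<Gamma> \<subseteq> \<Gamma>)"

lemma graph_invariantD: "graph_invariant \<Gamma> \<Longrightarrow> U \<in> commutant M \<Longrightarrow> (u, v) \<in> \<Gamma> \<Longrightarrow> (U u, U v) \<in> \<Gamma>"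
  by (auto simp: graph_invariant_def)

lemma operator_of_invariant_graph:
  assumes \<Gamma>: "closed_subspace \<Gamma>" and single: "\<And>v. (0, v) \<in> \<Gamma> \<Longrightarrow> v = 0" and cl: "closed (fst ` \<Gamma>)"
    and inv: "graph_invariant \<Gamma>"
  obtains C where "C \<in> M" "\<And>x. (oproj (fst ` \<Gamma>) x, C x) \<in> \<Gamma>"
proof -
  obtain C where C: "bounded_linear C" "\<And>x. (oproj (fst ` \<Gamma>) x, C x) \<in> \<Gamma>"
    using operator_of_graph[OF \<Gamma> single cl] by blast
  have "C (U x) = U (C x)" if U: "U \<in> commutant M" for U x
  proof (rule operator_of_graph_commute[OF \<Gamma> single cl C(2)])
    show "linear U" by (rule commutant_linear[OF U])
    show "inner (U x) y = inner x (cadjoint U y)" for x y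
      by (rule cadjoint_inner[OF commutant_bounded_op[OF U]])
    show "cadjoint U u \<in> fst ` \<Gamma>" if "u \<in> fst ` \<Gamma>" for u
      using graph_invariantD[OF inv commutant_adj[OF U]] that by force
    show "(U u, U v) \<in> \<Gamma>" if "(u, v) \<in> \<Gamma>" for u v
      by (rule graph_invariantD[OF inv U that])
  qed
  then have "C \<in> M" using C(1) by (intro memI)
  then show thesis using that C(2) by blast
qed

text \<open>Among the solutions \<open>y\<close> of \<open>B y = A x\<close> exactly one is
  orthogonal to the kernel of \<open>B\<close>. This choice is closed under limits and invariant
  under the commutant, so the solution relation is an operator in \<open>M\<close>.\<close>

theorem douglas_factorization:
  assumes A: "A \<in> M" and B: "B \<in> M" and ran: "range A \<subseteq> range B"
  obtains C where "C \<in> M" "A = B \<circ> C" "\<And>x. C x \<in> (null_space B)\<^sup>\<bottom>"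
proof -
  interpret A: bounded_linear A by (rule bl[OF A])
  interpret B: bounded_linear B by (rule bl[OF B])
  let ?N = "(null_space B)\<^sup>\<bottom>"
  note N = subspace_orthogonal_comp[of "null_space B"]
  let ?\<Gamma> = "{z. A (fst z) = B (snd z) \<and> snd z \<in> ?N}"
  have cl: "closed_subspace ?\<Gamma>"
    unfolding closed_subspace_def
  proof
    show "subspace ?\<Gamma>"
      using N by (auto simp: subspace_def A.add B.add A.scaleR B.scaleR A.zero B.zero)
    have "closed (snd -` ?N :: ('a \<times> 'a) set)"
      by (rule closed_vimage[OF closed_orthogonal_comp continuous_on_snd[OF continuous_on_id]])
    moreover have "closed {z. A (fst z) = B (snd z)}"
      by (intro closed_Collect_eq A.continuous_on B.continuous_on continuous_intros)
    ultimately have "closed ({z. A (fst z) = B (snd z)} \<inter> snd -` ?N)" by (intro closed_Int)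
    then show "closed ?\<Gamma>" by (simp add: Collect_conj_eq vimage_def)
  qed
  have single: "v = 0" if "(0, v) \<in> ?\<Gamma>" for v
  proof -
    have "v \<in> null_space B" "v \<in> ?N" using that by (auto simp: A.zero null_space_def)
    then have "inner v v = 0" unfolding in_orthogonal_comp by blast
    then show ?thesis by simp
  qed
  have total: "\<exists>y. (x, y) \<in> ?\<Gamma>" for x
  proof -
    obtain y where "A x = B y" using ran by blast
    then have "(x, y - null_proj B y) \<in> ?\<Gamma>"
      using null_proj_perp[OF bd[OF B], of y] null_proj_comp[OF bd[OF B], of y] by simp
    then show ?thesis by blast
  qed
  then have dom: "fst ` ?\<Gamma> = UNIV" by (force simp: image_iff)
  have "graph_invariant ?\<Gamma>"
    using invariantD[OF invariant_orthogonal_comp[OF invariant_null_space[OF B]]]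
    by (auto simp: graph_invariant_def commute[OF A] commute[OF B])
  then obtain C where C: "C \<in> M" "\<And>x. (oproj (fst ` ?\<Gamma>) x, C x) \<in> ?\<Gamma>"
    using operator_of_invariant_graph[OF cl single] dom by auto
  have "oproj (fst ` ?\<Gamma>) x = x" for x
    unfolding dom by (rule oproj_fix) (simp_all add: closed_subspace_def)
  then have "(x, C x) \<in> ?\<Gamma>" for x using C(2)[of x] by simp
  then show thesis by (intro that[OF C(1)]) auto
qed

section \<open>Kernel projections as suprema\<close>

lemma resolvent_mem:
  assumes "B \<in> M" "\<epsilon> > 0"
  shows "rsv (cadjoint B \<circ> B) \<epsilon> \<in> M"
proof (rule memI)
  interpret positive_operator "cadjoint B \<circ> B" by (rule positive_operator_cadjoint_comp[OF bd[OF assms(1)]])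
  show "bounded_linear (rsv (cadjoint B \<circ> B) \<epsilon>)" by (rule rsv_bounded_linear[OF assms(2)])
  fix U x assume U: "U \<in> commutant M"
  have "U \<circ> (cadjoint B \<circ> B) = (cadjoint B \<circ> B) \<circ> U"
    using commute[OF comp_mem[OF adj[OF assms(1)] assms(1)] U] by auto
  from fun_cong[OF rsv_commute[OF assms(2) commutant_linear[OF U] this], of x]
  show "rsv (cadjoint B \<circ> B) \<epsilon> (U x) = U (rsv (cadjoint B \<circ> B) \<epsilon> x)" by simp
qed

text \<open>Complements of resolvents, because normality is phrased with suprema: they increase as
  \<open>\<epsilon>\<close> decreases.\<close>

definition resolvent_net :: "('a \<Rightarrow> 'a) \<Rightarrow> ('a \<Rightarrow> 'a) set" where
  "resolvent_net B = (\<lambda>\<epsilon> x. x - rsv (cadjoint B \<circ> B) \<epsilon> x) ` {0<..}"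

lemma resolvent_net_selfadjoint: "B \<in> M \<Longrightarrow> resolvent_net B \<subseteq> selfadjoint_part M"
proof
  fix X assume B: "B \<in> M" and "X \<in> resolvent_net B"
  then obtain \<epsilon> where \<epsilon>: "\<epsilon> > 0" and X: "X = (\<lambda>x. x - rsv (cadjoint B \<circ> B) \<epsilon> x)"
    by (auto simp: resolvent_net_def)
  interpret positive_operator "cadjoint B \<circ> B" by (rule positive_operator_cadjoint_comp[OF bd[OF B]])
  have XM: "X \<in> M" using diff_mem[OF id_mem resolvent_mem[OF B \<epsilon>]] by (simp add: X)
  have "cadjoint X = X"
    by (rule cadjoint_unique[OF bd[OF XM]]) (simp only: X inner_diff rsv_sym[OF \<epsilon>])
  then show "X \<in> selfadjoint_part M" using XM by (simp add: selfadjoint_part_def)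
qed

text \<open>Leastness is checked one vector at a time: for given \<open>x\<close> a single member of
  the net already comes within any prescribed error of the limit.\<close>

lemma is_op_sup_resolvent_net:
  assumes B: "B \<in> M"
  shows "is_op_sup M (resolvent_net B) (\<lambda>x. x - null_proj B x)"
proof -
  let ?S = "cadjoint B \<circ> B"
  interpret positive_operator ?S by (rule positive_operator_cadjoint_comp[OF bd[OF B]])
  have np: "null_proj B = oproj {x. ?S x = 0}"
    using null_space_cadjoint_comp[OF bd[OF B]] by (simp add: null_proj_def null_space_def)
  let ?A = "\<lambda>x. x - null_proj B x"
  have AM: "?A \<in> M" using diff_mem[OF id_mem null_proj_mem[OF B]] by simp
  have "cadjoint ?A = ?A"
    by (rule cadjoint_unique[OF bd[OF AM]])
      (simp only: inner_diff np oproj_selfadjoint[OF kernel_closed_subspace])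
  then have A: "?A \<in> selfadjoint_part M" using AM by (simp add: selfadjoint_part_def)
  have le: "op_le X C \<longleftrightarrow> (\<forall>x. inner (X x) x \<le> inner (C x) x)"
    if "X \<in> selfadjoint_part M" "C \<in> selfadjoint_part M" for X C
    using that by (intro op_le_iff) (auto simp: selfadjoint_part_def bd)
  show ?thesis
    unfolding is_op_sup_def
  proof (intro conjI ballI impI A)
    fix X assume X: "X \<in> resolvent_net B"
    then show "op_le X ?A"
      using resolvent_net_selfadjoint[OF B] A oproj_kernel_le_rsv
      by (subst le) (auto simp: resolvent_net_def inner_diff_left np)
  next
    fix C assume C: "C \<in> selfadjoint_part M" and ub: "\<forall>X\<in>resolvent_net B. op_le X C"
    show "op_le ?A C"
      unfolding le[OF A C]
    proof
      fix x
      show "inner (?A x) x \<le> inner (C x) x"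
      proof (rule field_le_epsilon)
        fix e :: real assume e: "e > 0"
        \<comment> \<open>By Cauchy-Schwarz a vector error below \<open>d\<close> changes the form
          at \<open>x\<close> by at most \<open>d * (norm x + 1) = e\<close>.\<close>
        define d where "d = e / (norm x + 1)"
        have d: "d > 0" using e by (simp add: d_def add_nonneg_pos)
        obtain \<epsilon> where \<epsilon>: "\<epsilon> > 0" and near: "norm (rsv ?S \<epsilon> x - null_proj B x) < d"
          using rsv_tendsto_oproj_kernel[OF d, of x] unfolding np by blast
        have net: "(\<lambda>x. x - rsv ?S \<epsilon> x) \<in> resolvent_net B" using \<epsilon> by (simp add: resolvent_net_def)
        then have "inner (x - rsv ?S \<epsilon> x) x \<le> inner (C x) x"
          using ub le[OF _ C] resolvent_net_selfadjoint[OF B] by blast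
        moreover have "inner (rsv ?S \<epsilon> x - null_proj B x) x \<le> e"
        proof -
          have "inner (rsv ?S \<epsilon> x - null_proj B x) x \<le> norm (rsv ?S \<epsilon> x - null_proj B x) * norm x"
            by (rule norm_cauchy_schwarz)
          also have "\<dots> \<le> d * (norm x + 1)" using near d by (intro mult_mono) auto
          also have "\<dots> = e" by (simp add: d_def add_nonneg_eq_0_iff)
          finally show ?thesis .
        qed
        ultimately show "inner (?A x) x \<le> inner (C x) x + e" by (simp add: inner_diff_left)
      qed
    qed
  qed
qed

lemma resolvent_net_directed:
  assumes B: "B \<in> M"
  shows "\<forall>X\<in>resolvent_net B. \<forall>Y\<in>resolvent_net B. \<exists>Z\<in>resolvent_net B. op_le X Z \<and> op_le Y Z"
proof (intro ballI)
  interpret positive_operator "cadjoint B \<circ> B" by (rule positive_operator_cadjoint_comp[OF bd[OF B]])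
  fix X Y assume X: "X \<in> resolvent_net B" and Y: "Y \<in> resolvent_net B"
  let ?R = "\<lambda>\<epsilon> x. x - rsv (cadjoint B \<circ> B) \<epsilon> x"
  obtain \<delta> \<epsilon> where de: "\<delta> > 0" "X = ?R \<delta>" "\<epsilon> > 0" "Y = ?R \<epsilon>"
    using X Y by (auto simp: resolvent_net_def)
  have le: "op_le (?R a) (?R b)" if "0 < b" "b \<le> a" for a b
  proof -
    have "?R a \<in> selfadjoint_part M" "?R b \<in> selfadjoint_part M"
      using that resolvent_net_selfadjoint[OF B] unfolding resolvent_net_def by auto
    then show ?thesis
      using rsv_mono[OF that] by (subst op_le_iff) (auto simp: selfadjoint_part_def bd inner_diff_left)
  qed
  have "?R (min \<delta> \<epsilon>) \<in> resolvent_net B" using de by (auto simp: resolvent_net_def)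
  then show "\<exists>Z\<in>resolvent_net B. op_le X Z \<and> op_le Y Z" using de le by (intro bexI[of _ "?R (min \<delta> \<epsilon>)"]) auto
qed

end

section \<open>Quotients and invariant graphs\<close>

lemma graph_eqI: "Map.graph S = Map.graph T \<Longrightarrow> S = T"
proof
  fix x assume eq: "Map.graph S = Map.graph T"
  then have "S x = Some y \<longleftrightarrow> T x = Some y" for y unfolding Map.graph_def by blast
  then show "S x = T x" by (metis option.exhaust)
qed

lemma in_graph: "(x, y) \<in> Map.graph T \<longleftrightarrow> T x = Some y"
  by (simp add: Map.graph_def)

lemma op_closure_eq:
  assumes "unbounded_op S" "Map.graph S = closure (Map.graph T)"
  shows "op_closure T = S"
  unfolding op_closure_def using assms by (intro the_equality) (auto intro: graph_eqI)

lemma subspace_graph: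
  assumes "unbounded_op T"
  shows "subspace (Map.graph T)"
  unfolding subspace_def
proof (intro conjI ballI allI)
  show "0 \<in> Map.graph T" using assms by (simp add: unbounded_op_def in_graph zero_prod_def)
  show "x + y \<in> Map.graph T" if "x \<in> Map.graph T" "y \<in> Map.graph T" for x y
    using assms that by (cases x, cases y) (simp add: in_graph unbounded_op_def)
  show "c *\<^sub>R x \<in> Map.graph T" if "x \<in> Map.graph T" for x c
    using assms that by (cases x) (simp add: in_graph unbounded_op_def scaleR_scaleC)
qed

context
  fixes A B :: "'a::complex_hilbert \<Rightarrow> 'a"
  assumes A: "bounded_op A" and B: "bounded_op B" and null: "null_space B \<subseteq> null_space A"
begin

lemma quotient_op_well_defined: "B x = B y \<Longrightarrow> A x = A y"
proof -
  assume "B x = B y"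
  then have "x - y \<in> null_space B"
    by (simp add: null_space_def linear_diff[OF bounded_linear.linear[OF bounded_op_bounded_linear[OF B]]])
  then show "A x = A y"
    using null by (auto simp: null_space_def linear_diff[OF bounded_linear.linear[OF bounded_op_bounded_linear[OF A]]])
qed

lemma quotient_op_eq_Some: "quotient_op A B y = Some z \<longleftrightarrow> (\<exists>x. B x = y \<and> A x = z)"
proof -
  have "(THE z. \<exists>x'. B x' = B x \<and> z = A x') = A x" for x
    by (rule the_equality) (auto intro: quotient_op_well_defined)
  then have "quotient_op A B (B x) = Some (A x)" for x by (simp add: quotient_op_def)
  moreover have "quotient_op A B y = None" if "y \<notin> range B" using that by (simp add: quotient_op_def)
  ultimately show ?thesis by (metis option.distinct(1) option.inject rangeI quotient_op_well_defined imageE)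
qed

lemma graph_quotient_op: "Map.graph (quotient_op A B) = range (\<lambda>x. (B x, A x))"
  by (auto simp: in_graph quotient_op_eq_Some)

lemma dom_quotient_op: "dom (quotient_op A B) = range B"
  by (auto simp: quotient_op_def split: if_splits)

lemma unbounded_op_quotient_op: "unbounded_op (quotient_op A B)"
proof -
  interpret A: bounded_linear A by (rule bounded_op_bounded_linear[OF A])
  interpret B: bounded_linear B by (rule bounded_op_bounded_linear[OF B])
  have "A (c *\<^sub>C x) = c *\<^sub>C A x" "B (c *\<^sub>C x) = c *\<^sub>C B x" for c x
    using A B by (auto simp: bounded_op_def)
  note hom = this A.add B.add
  show ?thesis
    unfolding unbounded_op_def quotient_op_eq_Some
  proof (intro conjI allI impI)
    show "\<exists>x. B x = 0 \<and> A x = 0" by (intro exI[of _ 0]) (simp add: A.zero B.zero)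
    show "\<exists>z. B z = x + y \<and> A z = u + v" if "(\<exists>z. B z = x \<and> A z = u) \<and> (\<exists>z. B z = y \<and> A z = v)" for x y u v
      using that hom by metis
    show "\<exists>z. B z = c *\<^sub>C x \<and> A z = c *\<^sub>C u" if "\<exists>z. B z = x \<and> A z = u" for c x u
      using that hom by metis
  qed
qed

end

lemma inner_map_prod_adjoint:
  assumes "bounded_op U"
  shows "inner (map_prod U U z) w = inner z (map_prod (cadjoint U) (cadjoint U) w)"
  using assms by (cases z, cases w) (simp add: cadjoint_inner)

lemma linear_map_prod: "linear U \<Longrightarrow> linear V \<Longrightarrow> linear (map_prod U V)"
  by (rule linearI) (auto simp: linear_add linear_scale)

lemma bounded_linear_map_prod: "bounded_linear U \<Longrightarrow> bounded_linear V \<Longrightarrow> bounded_linear (map_prod U V)"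
  unfolding map_prod_def split_beta
  by (intro bounded_linear_Pair bounded_linear_compose[OF _ bounded_linear_fst] bounded_linear_compose[OF _ bounded_linear_snd])

section \<open>Quotients over a von Neumann algebra\<close>

context von_neumann
begin

definition quotient_pair :: "('a \<Rightarrow> 'a) \<Rightarrow> ('a \<Rightarrow> 'a) \<Rightarrow> bool" where
  "quotient_pair A B \<longleftrightarrow> A \<in> M \<and> B \<in> M \<and> null_space B \<subseteq> null_space A"

lemma in_M_aff: "T \<in> M_aff M \<longleftrightarrow> (\<exists>A B. quotient_pair A B \<and> T = quotient_op A B)"
  by (auto simp: M_aff_def quotient_pair_def)

context
  fixes A B
  assumes pair: "quotient_pair A B"
begin

lemma pair_mem: shows "A \<in> M" and "B \<in> M" and "null_space B \<subseteq> null_space A"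
  using pair by (auto simp: quotient_pair_def)

lemmas pair_bd = bd[OF pair_mem(1)] bd[OF pair_mem(2)] pair_mem(3)
lemmas pair_quotient_eq_Some = quotient_op_eq_Some[OF pair_bd]
lemmas pair_graph = graph_quotient_op[OF pair_bd]
lemmas pair_dom = dom_quotient_op[OF pair_bd]
lemmas pair_unbounded_op = unbounded_op_quotient_op[OF pair_bd]

lemma pair_null_proj: "A (x - null_proj B x) = A x" "B (x - null_proj B x) = B x"
proof -
  show B: "B (x - null_proj B x) = B x" by (rule null_proj_comp[OF pair_bd(2)])
  show "A (x - null_proj B x) = A x" by (rule quotient_op_well_defined[OF pair_bd B])
qed

text \<open>Given a left inverse \<open>L\<close>, the graph consists of the \<open>z\<close> with
  \<open>z = (B (L z), A (L z))\<close>, a closed condition. Conversely, on a closed graph the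
  inverse of \<open>x \<mapsto> (B x, A x)\<close> is bounded, and extending it by zero off the
  graph gives a left inverse on the whole direct sum.\<close>

lemma closed_quotient_op_iff:
  "closed_op (quotient_op A B) \<longleftrightarrow>
     (\<exists>L1\<in>M. \<exists>L2\<in>M. \<forall>x. L1 (B x) + L2 (A x) = x - null_proj B x)"
proof
  interpret A: bounded_linear A by (rule bl[OF pair_mem(1)])
  interpret B: bounded_linear B by (rule bl[OF pair_mem(2)])
  let ?G = "range (\<lambda>x. (B x, A x))"
  let ?N = "(null_space B)\<^sup>\<bottom>"
  {
    assume "\<exists>L1\<in>M. \<exists>L2\<in>M. \<forall>x. L1 (B x) + L2 (A x) = x - null_proj B x"
    then obtain L1 L2 where L: "L1 \<in> M" "L2 \<in> M" "\<And>x. L1 (B x) + L2 (A x) = x - null_proj B x" by blast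
    let ?L = "\<lambda>z. L1 (fst z) + L2 (snd z)"
    have "?G = {z. B (?L z) = fst z} \<inter> {z. A (?L z) = snd z}"
    proof (intro set_eqI iffI)
      fix z assume "z \<in> {z. B (?L z) = fst z} \<inter> {z. A (?L z) = snd z}"
      then have "z = (B (?L z), A (?L z))" by (simp add: prod_eq_iff)
      then show "z \<in> ?G" by (rule range_eqI)
    qed (auto simp: L pair_null_proj)
    moreover
    have blL: "bounded_linear ?L"
      by (intro bounded_linear_add bounded_linear_compose[OF bl[OF L(1)] bounded_linear_fst]
          bounded_linear_compose[OF bl[OF L(2)] bounded_linear_snd])
    have "closed ({z. B (?L z) = fst z} \<inter> {z. A (?L z) = snd z})"
      by (intro closed_Int closed_Collect_eq linear_continuous_on bounded_linear_fst bounded_linear_snd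
          bounded_linear_compose[OF A.bounded_linear_axioms blL] bounded_linear_compose[OF B.bounded_linear_axioms blL])
    ultimately show "closed_op (quotient_op A B)"
      by (simp add: closed_op_def pair_unbounded_op pair_graph)
  }
  assume "closed_op (quotient_op A B)"
  then have G: "closed ?G" by (simp add: closed_op_def pair_graph)
  have subG: "subspace ?G" using subspace_graph[OF pair_unbounded_op] by (simp add: pair_graph)
  \<comment> \<open>The inverse relation, from the graph of \<open>A/B\<close> to the orthogonal
    complement of the kernel of \<open>B\<close>.\<close>
  let ?\<Gamma> = "{z. (B (snd z), A (snd z)) = fst z \<and> snd z \<in> ?N}"
  have N: "invariant ?N" by (rule invariant_orthogonal_comp[OF invariant_null_space[OF pair_mem(2)]])
  have cl: "closed_subspace ?\<Gamma>"
    unfolding closed_subspace_def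
  proof
    show "subspace ?\<Gamma>"
      using subspace_orthogonal_comp[of "null_space B"]
      by (auto simp: subspace_def A.add B.add A.scaleR B.scaleR A.zero B.zero zero_prod_def)
    have "closed (snd -` ?N :: (('a \<times> 'a) \<times> 'a) set)"
      by (rule closed_vimage[OF closed_orthogonal_comp continuous_on_snd[OF continuous_on_id]])
    moreover have "closed {z. (B (snd z), A (snd z)) = fst z}"
      by (intro closed_Collect_eq A.continuous_on B.continuous_on continuous_intros)
    ultimately have "closed ({z. (B (snd z), A (snd z)) = fst z} \<inter> snd -` ?N)" by (intro closed_Int)
    then show "closed ?\<Gamma>" by (simp add: Collect_conj_eq vimage_def)
  qed
  have proj: "((B x, A x), x - null_proj B x) \<in> ?\<Gamma>" for x
    using null_proj_perp[OF pair_bd(2), of x] by (simp add: pair_null_proj)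
  have uniq: "v = x - null_proj B x" if "((B x, A x), v) \<in> ?\<Gamma>" for x v
  proof -
    have "B (x - v) = 0" "v \<in> ?N" using that by (auto simp: B.diff)
    then have "null_proj B x = x - v" unfolding null_proj_def
      by (intro oproj_eqI closed_subspace_null_space pair_bd) (auto simp: null_space_def)
    then show ?thesis by simp
  qed
  have single: "v = 0" if "(0, v) \<in> ?\<Gamma>" for v
    using uniq[of 0 v] that null_proj_fix[OF pair_bd(2) B.zero] by (simp add: A.zero B.zero zero_prod_def)
  have dom: "fst ` ?\<Gamma> = ?G"
  proof (intro set_eqI iffI)
    fix z assume "z \<in> ?G"
    then obtain x where "z = (B x, A x)" by auto
    then show "z \<in> fst ` ?\<Gamma>" using proj[of x] by (intro image_eqI[where x = "(z, x - null_proj B x)"]) auto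
  qed (auto simp: image_iff prod_eq_iff)
  then have cl_dom: "closed (fst ` ?\<Gamma>)" using G by simp
  have "closed_subspace ?G" using G subG by (simp add: closed_subspace_def)
  obtain C where C: "bounded_linear C" "\<And>z. (oproj (fst ` ?\<Gamma>) z, C z) \<in> ?\<Gamma>"
    using operator_of_graph[OF cl single cl_dom] by blast
  interpret C: bounded_linear C by fact
  have comm: "C (map_prod U U z) = U (C z)" if U: "U \<in> commutant M" for U z
  proof (rule operator_of_graph_commute[OF cl single cl_dom C(2)])
    show "linear (map_prod U U)" by (intro linear_map_prod commutant_linear U)
    show "inner (map_prod U U x) y = inner x (map_prod (cadjoint U) (cadjoint U) y)" for x y
      by (rule inner_map_prod_adjoint[OF commutant_bounded_op[OF U]])
    show "(map_prod U U u, U v) \<in> ?\<Gamma>" if "(u, v) \<in> ?\<Gamma>" for u v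
      using that invariantD[OF N U, of v] by (auto simp: commute[OF pair_mem(1) U] commute[OF pair_mem(2) U])
    show "map_prod (cadjoint U) (cadjoint U) u \<in> fst ` ?\<Gamma>" if "u \<in> fst ` ?\<Gamma>" for u
      using that unfolding dom
      by (auto simp: commute[OF pair_mem(1) commutant_adj[OF U], symmetric] commute[OF pair_mem(2) commutant_adj[OF U], symmetric])
  qed
  \<comment> \<open>The two coordinate restrictions of \<open>C\<close> are \<open>L1\<close> and
    \<open>L2\<close>; diagonal invariance under \<open>map_prod U U\<close> places each of them in
    \<open>M\<close>.\<close>
  have "(\<lambda>a. C (a, 0)) \<in> M"
  proof (rule memI)
    show "bounded_linear (\<lambda>a. C (a, 0))"
      by (intro bounded_linear_compose[OF C(1)] bounded_linear_Pair bounded_linear_ident bounded_linear_zero)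
    show "C (U x, 0) = U (C (x, 0))" if "U \<in> commutant M" for U x
      using comm[OF that, of "(x, 0)"] by (simp add: linear_0[OF commutant_linear[OF that]])
  qed
  moreover have "(\<lambda>a. C (0, a)) \<in> M"
  proof (rule memI)
    show "bounded_linear (\<lambda>a. C (0, a))"
      by (intro bounded_linear_compose[OF C(1)] bounded_linear_Pair bounded_linear_ident bounded_linear_zero)
    show "C (0, U x) = U (C (0, x))" if "U \<in> commutant M" for U x
      using comm[OF that, of "(0, x)"] by (simp add: linear_0[OF commutant_linear[OF that]])
  qed
  moreover have "C (B x, 0) + C (0, A x) = x - null_proj B x" for x
  proof -
    have "oproj ?G (B x, A x) = (B x, A x)" by (rule oproj_fix[OF \<open>closed_subspace ?G\<close>]) simp
    then have "((B x, A x), C (B x, A x)) \<in> ?\<Gamma>" using C(2)[of "(B x, A x)"] by (simp add: dom)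
    then have "C (B x, A x) = x - null_proj B x" by (rule uniq)
    then show ?thesis by (simp flip: C.add)
  qed
  ultimately show "\<exists>L1\<in>M. \<exists>L2\<in>M. \<forall>x. L1 (B x) + L2 (A x) = x - null_proj B x"
    by - (rule bexI[where x = "\<lambda>a. C (a, 0)"], rule bexI[where x = "\<lambda>a. C (0, a)"], auto)
qed

lemma graph_invariant_quotient_op: "graph_invariant (Map.graph (quotient_op A B))"
  by (auto simp: graph_invariant_def pair_graph
      commute[OF pair_mem(1), symmetric] commute[OF pair_mem(2), symmetric])

end

lemma graph_invariant_closure:
  assumes inv: "graph_invariant \<Gamma>"
  shows "graph_invariant (closure \<Gamma>)"
  unfolding graph_invariant_def
proof
  fix U assume U: "U \<in> commutant M"
  have "bounded_linear (map_prod U U)"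
    by (intro bounded_linear_map_prod bounded_op_bounded_linear commutant_bounded_op[OF U])
  then have "continuous_on (closure \<Gamma>) (map_prod U U)" by (rule linear_continuous_on)
  then show "map_prod U U ` closure \<Gamma> \<subseteq> closure \<Gamma>"
    using inv U closure_subset by (intro image_closure_subset) (auto simp: graph_invariant_def)
qed

text \<open>Let \<open>p\<close> be the projection onto the graph and \<open>R\<close> the square root of its upper left corner.
  Then \<open>R x \<mapsto> p (x, 0)\<close> is isometric, and its range is dense in the graph because no nonzero
  element of a graph is orthogonal to all \<open>(x, 0)\<close>.\<close>

theorem closed_invariant_in_M_aff:
  assumes T: "closed_op T" and inv: "graph_invariant (Map.graph T)"
  shows "T \<in> M_aff M"
proof -
  let ?G = "Map.graph T"
  have G: "closed_subspace ?G" using T subspace_graph by (auto simp: closed_op_def closed_subspace_def)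
  have G0: "v = 0" if "(0, v) \<in> ?G" for v
    using that T by (simp add: in_graph closed_op_def unbounded_op_def)
  define e where "e x = (x, 0::'a)" for x :: 'a
  define p where "p = oproj ?G"
  have ble: "bounded_linear e" unfolding e_def
    by (intro bounded_linear_Pair bounded_linear_ident bounded_linear_zero)
  interpret e: bounded_linear e by (rule ble)
  interpret p: bounded_linear p unfolding p_def by (rule bounded_linear_oproj[OF G])
  have psym: "inner (p z) w = inner z (p w)" for z w unfolding p_def by (rule oproj_selfadjoint[OF G])
  have pG: "p z \<in> ?G" for z unfolding p_def by (rule oproj_in[OF G])
  have pfix: "p z = z" if "z \<in> ?G" for z unfolding p_def by (rule oproj_fix[OF G that])
  have blU: "bounded_linear U" if "U \<in> commutant M" for U
    using commutant_bounded_op[OF that] bounded_op_bounded_linear by blast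
  have eU: "e (U x) = map_prod U U (e x)" if U: "U \<in> commutant M" for U x
    by (simp add: e_def linear_0[OF commutant_linear[OF U]])
  have pU: "p (map_prod U U z) = map_prod U U (p z)" if U: "U \<in> commutant M" for U z
    unfolding p_def
  proof (rule oproj_eqI[OF G])
    have V: "map_prod V V ` ?G \<subseteq> ?G" if "V \<in> commutant M" for V using inv that by (simp add: graph_invariant_def)
    show "map_prod U U (oproj ?G z) \<in> ?G" using V[OF U] oproj_in[OF G, of z] by blast
    have "inner (map_prod U U (z - oproj ?G z)) g = 0" if "g \<in> ?G" for g
    proof -
      have "map_prod (cadjoint U) (cadjoint U) g \<in> ?G" using V[OF commutant_adj[OF U]] that by blast
      then show ?thesis
        unfolding inner_map_prod_adjoint[OF commutant_bounded_op[OF U]]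
        using oproj_perp[OF G, of z] unfolding in_orthogonal_comp by blast
    qed
    then show "map_prod U U z - map_prod U U (oproj ?G z) \<in> ?G\<^sup>\<bottom>"
      by (simp add: in_orthogonal_comp linear_diff[OF linear_map_prod[OF commutant_linear[OF U] commutant_linear[OF U]]])
  qed
  \<comment> \<open>The identity minus the upper left corner of \<open>p\<close>, since
    \<open>sqrt_one_minus\<close> returns a root of the identity minus its argument.\<close>
  define X where "X x = x - fst (p (e x))" for x
  have blX: "bounded_linear X" unfolding X_def
    by (intro bounded_linear_sub bounded_linear_ident bounded_linear_compose[OF bounded_linear_fst]
        bounded_linear_compose[OF p.bounded_linear_axioms ble])
  have inner_e: "inner z (e y) = inner (fst z) y" for z y by (simp add: e_def inner_prod_def)
  have contr: "norm (X x) \<le> norm x" for x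
  proof -
    have "norm (X x) = norm (fst (e x - p (e x)))" by (simp add: X_def e_def)
    also have "\<dots> \<le> norm (e x - p (e x))" by (metis norm_fst_le prod.collapse)
    also have "\<dots> \<le> norm (e x)" unfolding p_def by (rule norm_oproj_diff_le[OF G])
    finally show ?thesis by (simp add: e_def)
  qed
  have symX: "inner (X x) y = inner x (X y)" for x y
    using psym[of "e x" "e y"] inner_e[of "p (e x)" y] inner_e[of "p (e y)" x]
    by (simp add: X_def inner_diff inner_commute)
  obtain R where R: "bounded_linear R" "\<And>x y. inner (R x) y = inner x (R y)" "\<And>x. R (R x) = x - X x"
    "\<And>Z. bounded_linear Z \<Longrightarrow> Z \<circ> X = X \<circ> Z \<Longrightarrow> Z \<circ> R = R \<circ> Z"
    using sqrt_one_minus[OF blX contr symX] by blast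
  interpret R: bounded_linear R by fact
  have RU: "R (U x) = U (R x)" if U: "U \<in> commutant M" for U x
  proof -
    have "U \<circ> X = X \<circ> U"
    proof
      fix x
      show "(U \<circ> X) x = (X \<circ> U) x"
        by (simp add: X_def linear_diff[OF commutant_linear[OF U]] eU[OF U] pU[OF U])
    qed
    from fun_cong[OF R(4)[OF blU[OF U] this], of x] show ?thesis by simp
  qed
  have iso: "norm (R x) = norm (p (e x))" for x
  proof -
    have "inner (R x) (R x) = inner x (fst (p (e x)))" by (simp add: R X_def)
    also have "\<dots> = inner (p (e x)) (e x)" by (simp only: inner_e inner_commute[of x])
    also have "\<dots> = inner (p (e x)) (p (e x))" using psym[of "p (e x)" "e x"] pfix[OF pG] by simp
    finally show ?thesis by (simp add: norm_eq_sqrt_inner)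
  qed
  let ?Q = "range (\<lambda>x. (R x, p (e x)))"
  let ?\<Gamma> = "closure ?Q"
  have blK: "bounded_linear (\<lambda>x. (R x, p (e x)))"
    by (intro bounded_linear_Pair R(1) bounded_linear_compose[OF p.bounded_linear_axioms ble])
  have sub0: "subspace ?Q"
    by (rule linear_subspace_image[OF bounded_linear.linear[OF blK] subspace_UNIV])
  have cl: "closed_subspace ?\<Gamma>" by (rule closed_subspace_closure[OF sub0])
  have "?\<Gamma> \<subseteq> {z. norm (fst z) = norm (snd z)}"
    by (rule closure_minimal) (auto simp: iso intro!: closed_Collect_eq continuous_intros)
  then have isoG: "norm u = norm v" if "(u, v) \<in> ?\<Gamma>" for u v using that by auto
  then have single: "v = 0" if "(0, v) \<in> ?\<Gamma>" for v using that by fastforce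
  \<comment> \<open>On an isometric relation
    \<open>norm z \<le> norm (fst z) + norm (snd z) = 2 * norm (fst z)\<close>, hence the factor
    1/2.\<close>
  have "complete (fst ` ?\<Gamma>)"
  proof (rule complete_isometric_image[of "1/2"])
    show "subspace ?\<Gamma>" using cl by (simp add: closed_subspace_def)
    show "\<forall>z\<in>?\<Gamma>. 1/2 * norm z \<le> norm (fst z)"
    proof
      fix z assume "z \<in> ?\<Gamma>"
      then show "1/2 * norm z \<le> norm (fst z)"
        using isoG[of "fst z" "snd z"] norm_Pair_le[of "fst z" "snd z"] by simp
    qed
  qed (auto simp: bounded_linear_fst complete_eq_closed)
  then have cl_dom: "closed (fst ` ?\<Gamma>)" by (rule complete_imp_closed)
  \<comment> \<open>A partial isometry. Once its range is known to be the whole graph, its first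
    component serves as denominator and its second as numerator.\<close>
  obtain W where W: "bounded_linear W" "\<And>x. (oproj (fst ` ?\<Gamma>) x, W x) \<in> ?\<Gamma>"
    using operator_of_graph[OF cl single cl_dom] by blast
  have inv\<Gamma>: "(U u, map_prod U U v) \<in> ?\<Gamma>" if U: "U \<in> commutant M" and uv: "(u, v) \<in> ?\<Gamma>" for U u v
  proof -
    have "bounded_linear (map_prod U (map_prod U U))"
      by (intro bounded_linear_map_prod blU U)
    then have "map_prod U (map_prod U U) ` ?\<Gamma> \<subseteq> ?\<Gamma>"
      by (intro image_closure_subset linear_continuous_on closed_closure)
        (auto simp: RU[OF U, symmetric] pU[OF U, symmetric] eU[OF U, symmetric] intro!: closure_subset[THEN subsetD])
    then show ?thesis using uv by auto
  qed
  have comm: "W (U x) = map_prod U U (W x)" if U: "U \<in> commutant M" for U x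
  proof (rule operator_of_graph_commute[OF cl single cl_dom W(2)])
    show "linear U" by (rule commutant_linear[OF U])
    show "inner (U x) y = inner x (cadjoint U y)" for x y
      by (rule cadjoint_inner[OF commutant_bounded_op[OF U]])
    show "(U u, map_prod U U v) \<in> ?\<Gamma>" if "(u, v) \<in> ?\<Gamma>" for u v by (rule inv\<Gamma>[OF U that])
    show "cadjoint U u \<in> fst ` ?\<Gamma>" if "u \<in> fst ` ?\<Gamma>" for u
      using that inv\<Gamma>[OF commutant_adj[OF U]] by force
  qed
  have "fst \<circ> W \<in> M" "snd \<circ> W \<in> M"
    by (intro memI; simp add: comm comp_def bounded_linear_compose[OF bounded_linear_fst W(1)]
        bounded_linear_compose[OF bounded_linear_snd W(1)])+
  moreover have "range W = ?G"
  proof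
    have "snd ` ?\<Gamma> \<subseteq> ?G"
      using G by (intro image_closure_subset) (auto simp: pG closed_subspace_def intro: continuous_intros)
    then show "range W \<subseteq> ?G" using W(2) by force
    have subE: "subspace (range (p \<circ> e))"
      by (rule linear_subspace_image[OF _ subspace_UNIV])
        (simp add: comp_def bounded_linear.linear bounded_linear_compose[OF p.bounded_linear_axioms ble])
    show "?G \<subseteq> range W"
    proof
      fix g assume g: "g \<in> ?G"
      \<comment> \<open>Orthogonality of \<open>y\<close> to every \<open>p (e x)\<close> says that
        \<open>fst (p y) = 0\<close>. As \<open>p y\<close> lies in a graph, it vanishes, so
        \<open>y\<close> is orthogonal to the graph.\<close>
      have "inner g y = 0" if y: "y \<in> (range (p \<circ> e))\<^sup>\<bottom>" for y
      proof -
        have "inner (fst (p y)) x = 0" for x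
          using y psym[of y "e x"] by (simp add: in_orthogonal_comp flip: inner_e)
        then have "fst (p y) = 0" by (metis inner_eq_zero_iff)
        then have "(0, snd (p y)) \<in> ?G" using pG[of y] by (metis prod.collapse)
        then have "p y = 0" using G0 \<open>fst (p y) = 0\<close> by (simp add: prod_eq_iff)
        then show ?thesis using psym[of g y] pfix[OF g] by simp
      qed
      then have g': "g \<in> closure (range (p \<circ> e))" unfolding in_closure_subspace_iff[OF subE] by blast
      have "complete (snd ` ?\<Gamma>)"
      proof (rule complete_isometric_image[of "1/2"])
        show "subspace ?\<Gamma>" using cl by (simp add: closed_subspace_def)
        show "\<forall>z\<in>?\<Gamma>. 1/2 * norm z \<le> norm (snd z)"
        proof
          fix z assume "z \<in> ?\<Gamma>"
          then show "1/2 * norm z \<le> norm (snd z)"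
            using isoG[of "fst z" "snd z"] norm_Pair_le[of "fst z" "snd z"] by simp
        qed
      qed (auto simp: bounded_linear_snd complete_eq_closed)
      then have "closed (snd ` ?\<Gamma>)" by (rule complete_imp_closed)
      moreover have "p (e x) \<in> snd ` ?\<Gamma>" for x
        by (rule image_eqI[where x = "(R x, p (e x))"]) (auto intro: closure_subset[THEN subsetD])
      ultimately have "closure (range (p \<circ> e)) \<subseteq> snd ` ?\<Gamma>" by (intro closure_minimal) auto
      then obtain u where u: "(u, g) \<in> ?\<Gamma>" using g' by auto
      have "u \<in> fst ` ?\<Gamma>" using u by force
      moreover have "closed_subspace (fst ` ?\<Gamma>)" by (rule closed_subspace_fst[OF cl single cl_dom])
      ultimately have "oproj (fst ` ?\<Gamma>) u = u" by (intro oproj_fix)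
      then have Wu: "(u, W u) \<in> ?\<Gamma>" using W(2)[of u] by simp
      have "W u = g" by (rule graph_unique[OF cl _ cl_dom Wu u]) (rule single)
      then show "g \<in> range W" by blast
    qed
  qed
  moreover have "null_space (fst \<circ> W) \<subseteq> null_space (snd \<circ> W)"
  proof
    fix x assume "x \<in> null_space (fst \<circ> W)"
    then have "(0, snd (W x)) = W x" by (simp add: null_space_def prod_eq_iff)
    then have "(0, snd (W x)) \<in> ?G" using \<open>range W = ?G\<close> by (metis rangeI)
    then show "x \<in> null_space (snd \<circ> W)" using G0 by (simp add: null_space_def)
  qed
  ultimately have pair: "quotient_pair (snd \<circ> W) (fst \<circ> W)" and ran: "range W = ?G"
    by (auto simp: quotient_pair_def)
  have "Map.graph (quotient_op (snd \<circ> W) (fst \<circ> W)) = ?G"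
    unfolding pair_graph[OF pair] ran[symmetric] by simp
  then show ?thesis using pair graph_eqI unfolding in_M_aff by metis
qed

end

section \<open>Affiliation tested by unitaries of the commutant\<close>

context von_neumann
begin

lemma commutant_add:
  assumes A: "A \<in> commutant M" and B: "B \<in> commutant M"
  shows "(\<lambda>x. A x + B x) \<in> commutant M"
proof (rule commutantI)
  show "bounded_op (\<lambda>x. A x + B x)" by (intro bounded_op_add commutant_bounded_op[OF A] commutant_bounded_op[OF B])
  show "A (C x) + B (C x) = C (A x + B x)" if C: "C \<in> M" for C x
    using commute[OF C A] commute[OF C B] linear_add[OF bounded_linear.linear[OF bl[OF C]]] by simp
qed

lemma commutant_scaleC:
  assumes A: "A \<in> commutant M"
  shows "(\<lambda>x. c *\<^sub>C A x) \<in> commutant M"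
proof (rule commutantI)
  show "bounded_op (\<lambda>x. c *\<^sub>C A x)"
    using bounded_op_comp[OF bounded_op_scaleC[of c] commutant_bounded_op[OF A]] by (simp add: comp_def)
  show "c *\<^sub>C A (C x) = C (c *\<^sub>C A x)" if C: "C \<in> M" for C x
    using commute[OF C A] bd[OF C] by (simp add: bounded_op_def)
qed

text \<open>The unitary is \<open>A + \<i> (1 - A\<^sup>2)\<^bsup>1/2\<^esup>\<close>.\<close>

lemma selfadjoint_contraction_unitary:
  assumes A: "A \<in> commutant M" and sa: "cadjoint A = A" and contr: "\<And>x. norm (A x) \<le> norm x"
  obtains U where "U \<in> commutant M" "unitary_op U" "\<And>x. U x + cadjoint U x = 2 *\<^sub>R A x"
proof -
  have bA: "bounded_op A" by (rule commutant_bounded_op[OF A])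
  interpret A: bounded_linear A by (rule bounded_op_bounded_linear[OF bA])
  have symA: "inner (A x) y = inner x (A y)" for x y using cadjoint_inner[OF bA, of x y] sa by simp
  have "bounded_linear (A \<circ> A)" by (rule bounded_op_bounded_linear[OF bounded_op_comp[OF bA bA]])
  moreover have "norm ((A \<circ> A) x) \<le> norm x" for x using contr[of "A x"] contr[of x] by simp
  moreover have "inner ((A \<circ> A) x) y = inner x ((A \<circ> A) y)" for x y by (simp add: symA)
  ultimately obtain R where R: "bounded_linear R" "\<And>x y. inner (R x) y = inner x (R y)"
    "\<And>x. R (R x) = x - (A \<circ> A) x"
    "\<And>Z. bounded_linear Z \<Longrightarrow> Z \<circ> (A \<circ> A) = (A \<circ> A) \<circ> Z \<Longrightarrow> Z \<circ> R = R \<circ> Z"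
    using sqrt_one_minus[of "A \<circ> A"] by blast
  \<comment> \<open>Whatever commutes with \<open>A\<close> commutes with its square and hence with
    \<open>R\<close>. Applied to scalars, to \<open>M\<close> and to \<open>A\<close> itself, this
    gives complex linearity of \<open>R\<close>, membership in the commutant, and
    \<open>A R = R A\<close>.\<close>
  have comm: "Z (R x) = R (Z x)" if "bounded_linear Z" "\<And>x. Z (A x) = A (Z x)" for Z x
    using fun_cong[OF R(4)[OF that(1)], of x] that(2) by (simp add: fun_eq_iff)
  have RC: "R (c *\<^sub>C x) = c *\<^sub>C R x" for c x
    using comm[OF bounded_op_bounded_linear[OF bounded_op_scaleC], of c x] bA by (simp add: bounded_op_def)
  have AC: "A (c *\<^sub>C x) = c *\<^sub>C A x" for c x using bA by (simp add: bounded_op_def)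
  have "R (C x) = C (R x)" if C: "C \<in> M" for C x
    by (rule comm[OF bl[OF C], symmetric]) (rule commute[OF C A])
  then have RM: "R \<in> commutant M"
    using R(1) RC by (intro commutantI) (simp_all add: bounded_op_def)
  have AR: "A (R x) = R (A x)" for x by (rule comm[OF A.bounded_linear_axioms]) simp
  interpret R: bounded_linear R by fact
  interpret i: bounded_linear "\<lambda>x::'a. c *\<^sub>C x" for c
    by (rule bounded_op_bounded_linear[OF bounded_op_scaleC])
  let ?U = "\<lambda>x. A x + \<i> *\<^sub>C R x" and ?V = "\<lambda>x. A x + (- \<i>) *\<^sub>C R x"
  have UM: "?U \<in> commutant M" by (intro commutant_add commutant_scaleC A RM)
  have cancel: "\<i> *\<^sub>C z + (- \<i>) *\<^sub>C z = 0" for z :: 'a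
    using scaleC_add_left[of \<i> "- \<i>" z] scaleR_scaleC[of 0 z] by simp
  have adj: "cadjoint ?U = ?V"
    by (rule cadjoint_unique[OF commutant_bounded_op[OF UM]])
      (simp add: inner_add symA inner_scaleC_left R(2) RC)
  have "?V (?U x) = x" "?U (?V x) = x" for x
    by (simp_all add: A.add R.add A.diff R.diff AC RC AR R(3) scaleC_scaleC i.add i.diff cancel algebra_simps)
  then have "unitary_op ?U" using commutant_bounded_op[OF UM] unfolding unitary_op_def adj by (auto simp: fun_eq_iff)
  moreover have "?U x + cadjoint ?U x = 2 *\<^sub>R A x" for x
    unfolding adj using cancel[of "R x"] by (simp add: scaleR_2 algebra_simps)
  ultimately show thesis using UM that by blast
qed

text \<open>Every element of the commutant is a linear combination of four unitaries of the commutant.\<close>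

lemma graph_invariantI_unitary:
  assumes T: "unbounded_op T"
    and inv: "\<And>U x y. U \<in> commutant M \<Longrightarrow> unitary_op U \<Longrightarrow> T x = Some y \<Longrightarrow> T (U x) = Some (U y)"
  shows "graph_invariant (Map.graph T)"
proof -
  have unitary_adj: "unitary_op (cadjoint U)" if "unitary_op U" for U :: "'a \<Rightarrow> 'a"
    using that by (simp add: unitary_op_def bounded_op_cadjoint cadjoint_cadjoint)
  have add: "T (x + y) = Some (u + v)" if "T x = Some u" "T y = Some v" for x y u v
    using T that by (simp add: unbounded_op_def)
  have scale: "T (c *\<^sub>C x) = Some (c *\<^sub>C u)" if "T x = Some u" for c x u
    using T that by (simp add: unbounded_op_def)
  have scaleR: "T (r *\<^sub>R x) = Some (r *\<^sub>R u)" if "T x = Some u" for r x u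
    using scale[OF that] by (simp add: scaleR_scaleC)
  have sa: "T (A x) = Some (A y)"
    if A: "A \<in> commutant M" and sa: "cadjoint A = A" and xy: "T x = Some y" for A x y
  proof -
    note bA = commutant_bounded_op[OF A]
    obtain K where K: "K > 0" "\<And>x. norm (A x) \<le> norm x * K"
      using bounded_linear.pos_bounded[OF bounded_op_bounded_linear[OF bA]] by blast

    \<comment> \<open>Division by the bound \<open>K\<close> yields a contraction; afterwards
      \<open>A\<close> is recovered as \<open>K / 2\<close> times the sum of a unitary and its
      adjoint.\<close>
    have BM: "(\<lambda>x. (1 / K) *\<^sub>R A x) \<in> commutant M"
      unfolding scaleR_scaleC by (rule commutant_scaleC[OF A])
    have "cadjoint (\<lambda>x. (1 / K) *\<^sub>R A x) = (\<lambda>x. (1 / K) *\<^sub>R A x)"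
      by (rule cadjoint_unique[OF commutant_bounded_op[OF BM]])
        (use cadjoint_inner[OF bA] sa in simp)
    moreover have "norm ((1 / K) *\<^sub>R A x) \<le> norm x" for x
      using K by (simp add: field_simps)
    ultimately obtain U where U: "U \<in> commutant M" "unitary_op U"
      "\<And>x. U x + cadjoint U x = 2 *\<^sub>R ((1 / K) *\<^sub>R A x)"
      using selfadjoint_contraction_unitary[OF BM] by blast
    have "T (U x + cadjoint U x) = Some (U y + cadjoint U y)"
      by (rule add[OF inv[OF U(1,2) xy] inv[OF commutant_adj[OF U(1)] unitary_adj[OF U(2)] xy]])
    then have "T ((K / 2) *\<^sub>R (U x + cadjoint U x)) = Some ((K / 2) *\<^sub>R (U y + cadjoint U y))"
      by (rule scaleR)
    then show ?thesis using K(1) by (simp add: U(3))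
  qed
  have gen: "T (A x) = Some (A y)" if A: "A \<in> commutant M" and xy: "T x = Some y" for A x y
  proof -
    let ?B = "cadjoint A"
    note bA = commutant_bounded_op[OF A]
    note B = commutant_adj[OF A]
    have HM: "(\<lambda>x. A x + ?B x) \<in> commutant M" by (rule commutant_add[OF A B])
    \<comment> \<open>The factor \<open>\<i>\<close> makes the skew part
      \<open>A - cadjoint A\<close> self-adjoint and is undone below by \<open>- \<i>\<close>. The
      difference is written with the scalar \<open>-1\<close> so that it is visibly a combination in
      the commutant.\<close>
    have KM: "(\<lambda>x. \<i> *\<^sub>C (A x + (-1) *\<^sub>C ?B x)) \<in> commutant M"
      by (intro commutant_add commutant_scaleC A B)
    have "cadjoint (\<lambda>x. A x + ?B x) = (\<lambda>x. A x + ?B x)"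
      by (rule cadjoint_unique[OF commutant_bounded_op[OF HM]])
        (simp add: inner_add cadjoint_inner[OF bA] cadjoint_inner'[OF bA])
    from sa[OF HM this xy] have 1: "T (A x + ?B x) = Some (A y + ?B y)" .
    have neg: "(-1) *\<^sub>C z = - z" for z :: 'a using scaleR_scaleC[of "-1" z] by simp
    have "cadjoint (\<lambda>x. \<i> *\<^sub>C (A x + (-1) *\<^sub>C ?B x)) = (\<lambda>x. \<i> *\<^sub>C (A x + (-1) *\<^sub>C ?B x))"
    proof (rule cadjoint_unique[OF commutant_bounded_op[OF KM]])
      fix x y
      have c: "A (c *\<^sub>C z) = c *\<^sub>C A z" "?B (c *\<^sub>C z) = c *\<^sub>C ?B z" for c z
        using bA bounded_op_cadjoint[OF bA] by (simp_all add: bounded_op_def)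
      have m: "(- \<i>) *\<^sub>C z = - (\<i> *\<^sub>C z)" for z :: 'a
        using scaleC_scaleC[of "-1" "\<i>" z] by (simp add: neg)
      interpret i: bounded_linear "\<lambda>x::'a. c *\<^sub>C x" for c
        by (rule bounded_op_bounded_linear[OF bounded_op_scaleC])
      show "inner (\<i> *\<^sub>C (A x + (-1) *\<^sub>C ?B x)) y = inner x (\<i> *\<^sub>C (A y + (-1) *\<^sub>C ?B y))"
        unfolding inner_scaleC_left[of "\<i>"] by (simp add: neg m inner_diff cadjoint_inner[OF bA] cadjoint_inner'[OF bA] c i.diff
          linear_neg[OF bounded_linear.linear[OF bounded_op_bounded_linear[OF bA]]]
          linear_neg[OF bounded_linear.linear[OF bounded_op_bounded_linear[OF bounded_op_cadjoint[OF bA]]]])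
    qed
    from scale[OF sa[OF KM this xy], of "- \<i>"]
    have 2: "T (A x - ?B x) = Some (A y - ?B y)" by (simp add: scaleC_scaleC neg)
    have "T ((1/2) *\<^sub>R ((A x + ?B x) + (A x - ?B x))) = Some ((1/2) *\<^sub>R ((A y + ?B y) + (A y - ?B y)))"
      by (rule scaleR[OF add[OF 1 2]])
    then show ?thesis by (simp flip: scaleR_2)
  qed
  then show ?thesis by (auto simp: graph_invariant_def in_graph)
qed

text \<open>This trades a condition on the commutant, about which \<open>\<Phi>\<close> says
  nothing, for membership in \<open>M_aff\<close> and closedness, both of which
  \<open>\<Phi>\<close> transports.\<close>

theorem M_aff_MvN_eq: "M_aff_MvN M = {T \<in> M_aff M. closed_op T}"
proof (intro set_eqI iffI)
  fix T assume T: "T \<in> M_aff_MvN M"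
  have cl: "closed_op T" using T by (simp add: M_aff_MvN_def)
  have "T (U x) = Some (U y)" if U: "U \<in> commutant M" "unitary_op U" and xy: "T x = Some y" for U x y
  proof -
    have "map_option (cadjoint U) (T (U x)) = Some y"
      using T U xy by (auto simp: M_aff_MvN_def fun_eq_iff)
    then obtain z where z: "T (U x) = Some z" "cadjoint U z = y" by auto
    then have "U y = z" using U(2) by (auto simp: unitary_op_def fun_eq_iff)
    then show ?thesis using z by simp
  qed
  then have "graph_invariant (Map.graph T)" using cl by (intro graph_invariantI_unitary) (auto simp: closed_op_def)
  then show "T \<in> {T \<in> M_aff M. closed_op T}" using cl closed_invariant_in_M_aff by simp
next
  fix T assume "T \<in> {T \<in> M_aff M. closed_op T}"
  then have cl: "closed_op T" and inv: "graph_invariant (Map.graph T)"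
    using graph_invariant_quotient_op by (auto simp: in_M_aff)
  have "map_option (cadjoint U) \<circ> T \<circ> U = T" if U: "U \<in> commutant M" "unitary_op U" for U
  proof
    fix x
    have id: "cadjoint U (U z) = z" "U (cadjoint U z) = z" for z
      using U(2) by (auto simp: unitary_op_def fun_eq_iff)
    show "(map_option (cadjoint U) \<circ> T \<circ> U) x = T x"
    proof (cases "T x")
      case (Some y)
      then have "T (U x) = Some (U y)" using graph_invariantD[OF inv U(1), of x y] by (simp add: in_graph)
      then show ?thesis using Some by (simp add: id)
    next
      case None
      \<comment> \<open>Equality includes domains: if \<open>U x\<close> were in the domain,
        invariance under the adjoint of \<open>U\<close> would bring \<open>x\<close> back into
        it.\<close>
      have "T (U x) = None"
      proof (rule ccontr)
        assume "T (U x) \<noteq> None"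
        then obtain y where "T (U x) = Some y" by auto
        then have "T (cadjoint U (U x)) = Some (cadjoint U y)"
          using graph_invariantD[OF inv commutant_adj[OF U(1)], of "U x" y] by (simp add: in_graph)
        then show False using None by (simp add: id)
      qed
      then show ?thesis using None by simp
    qed
  qed
  then show "T \<in> M_aff_MvN M" using cl by (simp add: M_aff_MvN_def)
qed

text \<open>Douglas applied to the denominators gives \<open>C\<close>. The numerators then follow,
  because the value of \<open>B'\<close> at a point determines that of \<open>A'\<close>.\<close>

lemma quotient_op_le_factorization:
  assumes p: "quotient_pair A B" and p': "quotient_pair A' B'"
    and le: "Map.graph (quotient_op A B) \<subseteq> Map.graph (quotient_op A' B')"
  obtains C where "C \<in> M" "A = A' \<circ> C" "B = B' \<circ> C" "\<And>x. C x \<in> (null_space B')\<^sup>\<bottom>"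
proof -
  have gr: "\<exists>w. B x = B' w \<and> A x = A' w" for x
    using le unfolding pair_graph[OF p] pair_graph[OF p'] by auto
  then have "range B \<subseteq> range B'" by blast
  then obtain C where C: "C \<in> M" "B = B' \<circ> C" "\<And>x. C x \<in> (null_space B')\<^sup>\<bottom>"
    using douglas_factorization[OF pair_mem(2)[OF p] pair_mem(2)[OF p']] by blast
  have "A x = A' (C x)" for x
  proof -
    obtain w where "B x = B' w" "A x = A' w" using gr by blast
    then show ?thesis using quotient_op_well_defined[OF pair_bd[OF p'], of "C x" w] C(2) by simp
  qed
  then have "A = A' \<circ> C" by auto
  then show thesis by (rule that[OF C(1) _ C(2,3)])
qed

end

section \<open>Normal homomorphisms\<close>

locale normal_unital_hom = M: von_neumann M + N: von_neumann N
  for M :: "('a::complex_hilbert \<Rightarrow> 'a) set" and N :: "('b::complex_hilbert \<Rightarrow> 'b) set" +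
  fixes \<Phi> :: "('a \<Rightarrow> 'a) \<Rightarrow> ('b \<Rightarrow> 'b)"
  assumes star: "star_homomorphism M N \<Phi>" and unital: "unital_map \<Phi>" and normal: "normal_map M N \<Phi>"
begin

lemma hom_mem: "A \<in> M \<Longrightarrow> \<Phi> A \<in> N"
  using star by (auto simp: star_homomorphism_def)

lemma hom_add: "A \<in> M \<Longrightarrow> B \<in> M \<Longrightarrow> \<Phi> (\<lambda>x. A x + B x) = (\<lambda>y. \<Phi> A y + \<Phi> B y)"
  using star by (auto simp: star_homomorphism_def)

lemma hom_scaleC: "A \<in> M \<Longrightarrow> \<Phi> (\<lambda>x. c *\<^sub>C A x) = (\<lambda>y. c *\<^sub>C \<Phi> A y)"
  using star by (auto simp: star_homomorphism_def)

lemma hom_comp: "A \<in> M \<Longrightarrow> B \<in> M \<Longrightarrow> \<Phi> (A \<circ> B) = \<Phi> A \<circ> \<Phi> B"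
  using star by (auto simp: star_homomorphism_def)

lemma hom_adj: "A \<in> M \<Longrightarrow> \<Phi> (cadjoint A) = cadjoint (\<Phi> A)"
  using star by (auto simp: star_homomorphism_def)

lemma hom_id: "\<Phi> id = id"
  using unital by (simp add: unital_map_def)

lemma hom_diff: "A \<in> M \<Longrightarrow> B \<in> M \<Longrightarrow> \<Phi> (\<lambda>x. A x - B x) = (\<lambda>y. \<Phi> A y - \<Phi> B y)"
proof -
  assume AB: "A \<in> M" "B \<in> M"
  have neg: "(-1) *\<^sub>C z = - z" for z :: "'c::complex_hilbert" using scaleR_scaleC[of "-1" z] by simp
  have "\<Phi> (\<lambda>x. A x + (-1) *\<^sub>C B x) = (\<lambda>y. \<Phi> A y + (-1) *\<^sub>C \<Phi> B y)"
    using hom_add[OF AB(1) M.scaleC_mem[OF AB(2)]] by (simp add: hom_scaleC[OF AB(2)])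
  then show ?thesis by (simp add: neg)
qed

lemma hom_zero: "\<Phi> (\<lambda>x. 0) = (\<lambda>y. 0)"
  using hom_diff[OF M.id_mem M.id_mem] by simp

text \<open>The resolvent solves \<open>S R + \<epsilon> R = \<epsilon>\<close>, an equation in
  \<open>M\<close>. \<open>\<Phi>\<close> carries it to \<open>N\<close>, where the solution is
  unique.\<close>

lemma hom_resolvent:
  assumes B: "B \<in> M" and \<epsilon>: "\<epsilon> > 0"
  shows "\<Phi> (rsv (cadjoint B \<circ> B) \<epsilon>) = rsv (cadjoint (\<Phi> B) \<circ> \<Phi> B) \<epsilon>"
proof
  fix y
  let ?S = "cadjoint B \<circ> B" and ?R = "rsv (cadjoint B \<circ> B) \<epsilon>"
  interpret S: positive_operator ?S by (rule positive_operator_cadjoint_comp[OF M.bd[OF B]])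
  interpret S': positive_operator "cadjoint (\<Phi> B) \<circ> \<Phi> B"
    by (rule positive_operator_cadjoint_comp[OF N.bd[OF hom_mem[OF B]]])
  note S = M.comp_mem[OF M.adj[OF B] B] and R = M.resolvent_mem[OF B \<epsilon>]
  have "(\<lambda>x. (?S \<circ> ?R) x + complex_of_real \<epsilon> *\<^sub>C ?R x) = (\<lambda>x. complex_of_real \<epsilon> *\<^sub>C id x)"
    using S.rsv_eq[OF \<epsilon>] by (simp add: scaleR_scaleC)
  then have "\<Phi> (\<lambda>x. (?S \<circ> ?R) x + complex_of_real \<epsilon> *\<^sub>C ?R x) = \<Phi> (\<lambda>x. complex_of_real \<epsilon> *\<^sub>C id x)" by simp
  then have "(\<lambda>y. (\<Phi> ?S \<circ> \<Phi> ?R) y + complex_of_real \<epsilon> *\<^sub>C \<Phi> ?R y) = (\<lambda>y. complex_of_real \<epsilon> *\<^sub>C id y)"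
    by (simp only: hom_add[OF M.comp_mem[OF S R] M.scaleC_mem[OF R]] hom_comp[OF S R] hom_scaleC[OF R]
        hom_scaleC[OF M.id_mem] hom_id)
  then have "\<Phi> ?S (\<Phi> ?R y) + \<epsilon> *\<^sub>R \<Phi> ?R y = \<epsilon> *\<^sub>R y" by (simp add: fun_eq_iff scaleR_scaleC)
  then show "\<Phi> ?R y = rsv (cadjoint (\<Phi> B) \<circ> \<Phi> B) \<epsilon> y"
    using S'.rsv_eqI[OF \<epsilon>] by (simp add: hom_comp[OF M.adj[OF B] B] hom_adj[OF B])
qed

text \<open>The only use of normality.\<close>

theorem hom_null_proj:
  assumes B: "B \<in> M"
  shows "\<Phi> (null_proj B) = null_proj (\<Phi> B)"
proof -
  note P = M.null_proj_mem[OF B]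
  have img: "\<Phi> ` M.resolvent_net B = N.resolvent_net (\<Phi> B)"
  proof -
    have "\<Phi> (\<lambda>x. x - rsv (cadjoint B \<circ> B) \<epsilon> x) = (\<lambda>x. x - rsv (cadjoint (\<Phi> B) \<circ> \<Phi> B) \<epsilon> x)" if "\<epsilon> > 0" for \<epsilon>
      using hom_diff[OF M.id_mem M.resolvent_mem[OF B that]] by (simp add: hom_id hom_resolvent[OF B that])
    then show ?thesis unfolding M.resolvent_net_def N.resolvent_net_def image_image by (intro image_cong) auto
  qed
  have "M.resolvent_net B \<noteq> {}" by (auto simp: M.resolvent_net_def)
  then have "is_op_sup N (\<Phi> ` M.resolvent_net B) (\<Phi> (\<lambda>x. x - null_proj B x))"
    using normal M.resolvent_net_selfadjoint[OF B] M.resolvent_net_directed[OF B] M.is_op_sup_resolvent_net[OF B]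
    unfolding normal_map_def by blast
  then have "\<Phi> (\<lambda>x. x - null_proj B x) = (\<lambda>x. x - null_proj (\<Phi> B) x)"
    using N.is_op_sup_resolvent_net[OF hom_mem[OF B]] is_op_sup_unique[OF N.bd] unfolding img by blast
  moreover have "\<Phi> (\<lambda>x. x - null_proj B x) = (\<lambda>x. x - \<Phi> (null_proj B) x)"
    using hom_diff[OF M.id_mem P] by (simp add: hom_id)
  ultimately show ?thesis by (simp add: fun_eq_iff)
qed

text \<open>The inclusion of kernels is the algebraic relation
  \<open>A \<circ> null_proj B = 0\<close>.\<close>

lemma hom_null_space_mono:
  assumes A: "A \<in> M" and B: "B \<in> M" and null: "null_space B \<subseteq> null_space A"
  shows "null_space (\<Phi> B) \<subseteq> null_space (\<Phi> A)"
proof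
  fix y assume "y \<in> null_space (\<Phi> B)"
  then have "null_proj (\<Phi> B) y = y"
    by (intro null_proj_fix N.bd hom_mem B) (simp add: null_space_def)
  moreover have zero: "A \<circ> null_proj B = (\<lambda>x. 0)"
    using null null_proj_null[OF M.bd[OF B]] by (auto simp: null_space_def fun_eq_iff)
  have "\<Phi> A \<circ> \<Phi> (null_proj B) = (\<lambda>y. 0)"
    unfolding hom_comp[OF A M.null_proj_mem[OF B], symmetric] zero by (rule hom_zero)
  then have "\<Phi> A (\<Phi> (null_proj B) y) = 0" by (rule comp_eq_dest_lhs)
  ultimately show "y \<in> null_space (\<Phi> A)" by (simp add: hom_null_proj[OF B] null_space_def)
qed

lemma hom_quotient_pair: "M.quotient_pair A B \<Longrightarrow> N.quotient_pair (\<Phi> A) (\<Phi> B)"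
  using hom_mem hom_null_space_mono by (auto simp: M.quotient_pair_def N.quotient_pair_def)

lemma hom_range_mono:
  assumes A: "A \<in> M" and B: "B \<in> M" and ran: "range A \<subseteq> range B"
  shows "range (\<Phi> A) \<subseteq> range (\<Phi> B)"
proof -
  obtain C where C: "C \<in> M" "A = B \<circ> C" using M.douglas_factorization[OF A B ran] by blast
  then show ?thesis using hom_comp[OF B C(1)] by auto
qed

text \<open>Density is tested against the null projection of the adjoint, which \<open>\<Phi>\<close> preserves.\<close>

lemma hom_range_closure_mono:
  assumes P: "P \<in> M" and C: "C \<in> M" and ran: "range P \<subseteq> closure (range C)"
  shows "range (\<Phi> P) \<subseteq> closure (range (\<Phi> C))"
proof -
  let ?F = "null_proj (cadjoint C)"
  note F = M.null_proj_mem[OF M.adj[OF C]]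
  note KC = closed_subspace_null_space[OF M.bd[OF M.adj[OF C]]]
  note KC' = closed_subspace_null_space[OF N.bd[OF N.adj[OF hom_mem[OF C]]]]
  have "?F (P x) = 0" for x
  proof -
    have "inner (P x) y = 0" if "y \<in> null_space (cadjoint C)" for y
      using ran that in_closure_subspace_iff[OF subspace_range[OF M.bd[OF C]], of "P x"]
      by (auto simp: orthogonal_comp_range[OF M.bd[OF C]])
    then show ?thesis unfolding null_proj_def by (intro oproj_zero[OF KC]) (simp add: in_orthogonal_comp)
  qed
  then have zero: "?F \<circ> P = (\<lambda>x. 0)" by auto
  have "\<Phi> ?F \<circ> \<Phi> P = (\<lambda>y. 0)"
    unfolding hom_comp[OF F P, symmetric] zero by (rule hom_zero)
  then have "\<Phi> ?F (\<Phi> P y) = 0" for y by (rule comp_eq_dest_lhs)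
  then have z: "null_proj (cadjoint (\<Phi> C)) (\<Phi> P y) = 0" for y
    by (simp add: hom_null_proj[OF M.adj[OF C]] hom_adj[OF C])
  have "\<Phi> P y \<in> closure (range (\<Phi> C))" for y
  proof -
    have "\<Phi> P y \<in> (null_space (cadjoint (\<Phi> C)))\<^sup>\<bottom>"
      using null_proj_perp[OF N.bd[OF N.adj[OF hom_mem[OF C]]], of "\<Phi> P y"] by (simp add: z)
    then show ?thesis
      unfolding in_closure_subspace_iff[OF subspace_range[OF N.bd[OF hom_mem[OF C]]]]
        orthogonal_comp_range[OF N.bd[OF hom_mem[OF C]]] by (simp add: in_orthogonal_comp)
  qed
  then show ?thesis by auto
qed

section \<open>Transport of quotients\<close>

text \<open>An extension of quotients amounts to a common right factor \<open>C\<close> in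
  \<open>M\<close>, which \<open>\<Phi>\<close> preserves. Used in both directions it shows that
  \<open>Phi_aff\<close> is independent of the representation; used once it compares
  \<open>T\<close> with its closure.\<close>

lemma hom_quotient_op_mono:
  assumes p: "M.quotient_pair A B" and p': "M.quotient_pair A' B'"
    and le: "Map.graph (quotient_op A B) \<subseteq> Map.graph (quotient_op A' B')"
  shows "Map.graph (quotient_op (\<Phi> A) (\<Phi> B)) \<subseteq> Map.graph (quotient_op (\<Phi> A') (\<Phi> B'))"
proof -
  obtain C where C: "C \<in> M" "A = A' \<circ> C" "B = B' \<circ> C" by (rule M.quotient_op_le_factorization[OF p p' le])
  have "\<Phi> A = \<Phi> A' \<circ> \<Phi> C" "\<Phi> B = \<Phi> B' \<circ> \<Phi> C"
    using C hom_comp M.pair_mem[OF p'] by auto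
  then show ?thesis
    unfolding N.pair_graph[OF hom_quotient_pair[OF p]] N.pair_graph[OF hom_quotient_pair[OF p']] by auto
qed

lemma Phi_aff_quotient_op:
  assumes p: "M.quotient_pair A B"
  shows "Phi_aff M \<Phi> (quotient_op A B) = quotient_op (\<Phi> A) (\<Phi> B)"
  unfolding Phi_aff_def
proof (rule the_equality)
  show "\<exists>A'\<in>M. \<exists>B'\<in>M. null_space B' \<subseteq> null_space A' \<and> quotient_op A B = quotient_op A' B' \<and>
      quotient_op (\<Phi> A) (\<Phi> B) = quotient_op (\<Phi> A') (\<Phi> B')"
    using p by (auto simp: M.quotient_pair_def)
  fix S assume "\<exists>A'\<in>M. \<exists>B'\<in>M. null_space B' \<subseteq> null_space A' \<and> quotient_op A B = quotient_op A' B' \<and>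
      S = quotient_op (\<Phi> A') (\<Phi> B')"
  then obtain A' B' where p': "M.quotient_pair A' B'" and eq: "quotient_op A B = quotient_op A' B'"
    and S: "S = quotient_op (\<Phi> A') (\<Phi> B')" by (auto simp: M.quotient_pair_def)
  show "S = quotient_op (\<Phi> A) (\<Phi> B)"
    unfolding S using hom_quotient_op_mono[OF p p'] hom_quotient_op_mono[OF p' p]
    by (intro graph_eqI subset_antisym) (simp_all add: eq)
qed

lemma Phi_aff_s_range:
  assumes A: "A \<in> M"
  shows "Phi_aff_s M \<Phi> (range A) = range (\<Phi> A)"
  unfolding Phi_aff_s_def
proof (rule the_equality)
  show "\<exists>A'\<in>M. range A = range A' \<and> range (\<Phi> A) = range (\<Phi> A')" using A by blast
  show "W = range (\<Phi> A)" if "\<exists>A'\<in>M. range A = range A' \<and> W = range (\<Phi> A')" for W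
    using that hom_range_mono A by blast
qed

context
  fixes A B
  assumes pair: "M.quotient_pair A B"
begin

lemmas hom_pair = hom_quotient_pair[OF pair]
lemmas mem = M.pair_mem(1)[OF pair] M.pair_mem(2)[OF pair]

lemma hom_quotient_op_densely_defined:
  assumes "densely_defined (quotient_op A B)"
  shows "densely_defined (quotient_op (\<Phi> A) (\<Phi> B))"
proof -
  have "range id \<subseteq> closure (range B)" using assms by (simp add: densely_defined_def M.pair_dom[OF pair])
  then have "range (\<Phi> id) \<subseteq> closure (range (\<Phi> B))" by (rule hom_range_closure_mono[OF M.id_mem mem(2)])
  then show ?thesis by (auto simp: hom_id densely_defined_def N.pair_dom[OF hom_pair])
qed

lemma hom_quotient_op_closed:
  assumes "closed_op (quotient_op A B)"
  shows "closed_op (quotient_op (\<Phi> A) (\<Phi> B))"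
proof -
  obtain L1 L2 where L: "L1 \<in> M" "L2 \<in> M" "\<And>x. L1 (B x) + L2 (A x) = x - null_proj B x"
    using assms unfolding M.closed_quotient_op_iff[OF pair] by blast
  have "(\<lambda>x. (L1 \<circ> B) x + (L2 \<circ> A) x) = (\<lambda>x. id x - null_proj B x)" by (simp add: L)
  then have "\<Phi> (\<lambda>x. (L1 \<circ> B) x + (L2 \<circ> A) x) = \<Phi> (\<lambda>x. id x - null_proj B x)" by (rule arg_cong)
  then have "(\<lambda>y. (\<Phi> L1 \<circ> \<Phi> B) y + (\<Phi> L2 \<circ> \<Phi> A) y) = (\<lambda>y. id y - null_proj (\<Phi> B) y)"
    by (simp only: hom_add[OF M.comp_mem[OF L(1) mem(2)] M.comp_mem[OF L(2) mem(1)]]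
        hom_diff[OF M.id_mem M.null_proj_mem[OF mem(2)]] hom_comp[OF L(1) mem(2)] hom_comp[OF L(2) mem(1)]
        hom_id hom_null_proj[OF mem(2)])
  then have "\<Phi> L1 (\<Phi> B y) + \<Phi> L2 (\<Phi> A y) = y - null_proj (\<Phi> B) y" for y by (simp add: fun_eq_iff)
  then show ?thesis
    unfolding N.closed_quotient_op_iff[OF hom_pair] using hom_mem L by blast
qed

text \<open>The domain of a closed bounded operator is closed, so the operator extends by zero to
  some \<open>C\<close> in \<open>M\<close> with \<open>A = C \<circ> B\<close>. Then
  \<open>\<Phi> C\<close> is bounded and bounds the image quotient.\<close>

lemma hom_quotient_op_bounded:
  assumes "closed_op (quotient_op A B)" "bounded_on_dom (quotient_op A B)"
  shows "bounded_on_dom (quotient_op (\<Phi> A) (\<Phi> B))"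
proof -
  let ?G = "Map.graph (quotient_op A B)"
  obtain K where K: "\<And>x y. quotient_op A B x = Some y \<Longrightarrow> norm y \<le> K * norm x"
    using assms(2) by (auto simp: bounded_on_dom_def)
  have G: "closed_subspace ?G"
    using assms(1) subspace_graph by (auto simp: closed_op_def closed_subspace_def)
  have single: "v = 0" if "(0, v) \<in> ?G" for v using K[of 0 v] that by (simp add: in_graph)
  have "complete (fst ` ?G)"
  \<comment> \<open>On the graph \<open>norm z \<le> (1 + \<bar>K\<bar>) * norm (fst z)\<close>; the
    absolute value is there because \<open>K\<close> may be negative when the domain is
    trivial.\<close>
  proof (rule complete_isometric_image[of "1 / (1 + \<bar>K\<bar>)"])
    show "subspace ?G" using G by (simp add: closed_subspace_def)
    show "\<forall>z\<in>?G. 1 / (1 + \<bar>K\<bar>) * norm z \<le> norm (fst z)"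
    proof
      fix z assume "z \<in> ?G"
      then have "norm (snd z) \<le> K * norm (fst z)" using K[of "fst z" "snd z"] by (simp add: in_graph[symmetric])
      also have "\<dots> \<le> \<bar>K\<bar> * norm (fst z)" by (intro mult_right_mono) auto
      finally have "norm z \<le> (1 + \<bar>K\<bar>) * norm (fst z)"
        using norm_Pair_le[of "fst z" "snd z"] by (simp add: algebra_simps)
      then show "1 / (1 + \<bar>K\<bar>) * norm z \<le> norm (fst z)" by (simp add: field_simps)
    qed
    show "0 < 1 / (1 + \<bar>K\<bar>)" by (simp add: add_pos_nonneg)
  qed (use G in \<open>auto simp: bounded_linear_fst complete_eq_closed closed_subspace_def\<close>)
  then have cl: "closed (fst ` ?G)" by (rule complete_imp_closed)
  obtain C where C: "C \<in> M" "\<And>x. (oproj (fst ` ?G) x, C x) \<in> ?G"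
    using M.operator_of_invariant_graph[OF G single cl M.graph_invariant_quotient_op[OF pair]] by blast
  have "A x = C (B x)" for x
  proof -
    have BA: "(B x, A x) \<in> ?G" by (simp add: M.pair_graph[OF pair])
    then have "B x \<in> fst ` ?G" by force
    moreover have "closed_subspace (fst ` ?G)" by (rule closed_subspace_fst[OF G single cl])
    ultimately have "oproj (fst ` ?G) (B x) = B x" by (intro oproj_fix)
    then have "(B x, C (B x)) \<in> ?G" using C(2)[of "B x"] by simp
    with BA show ?thesis by (simp add: in_graph)
  qed
  then have "A = C \<circ> B" by auto
  then have hA: "\<Phi> A = \<Phi> C \<circ> \<Phi> B" using hom_comp[OF C(1) mem(2)] by simp
  obtain K' where "\<And>y. norm (\<Phi> C y) \<le> norm y * K'"
    using bounded_linear.bounded[OF N.bl[OF hom_mem[OF C(1)]]] by blast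
  then show ?thesis
    unfolding bounded_on_dom_def N.pair_quotient_eq_Some[OF hom_pair] unfolding hA
    by (intro exI[of _ K']) (auto simp: mult.commute)
qed

end

text \<open>Writing the closure of \<open>A/B\<close> as \<open>A'/B'\<close> with \<open>A = A' C\<close> and \<open>B = B' C\<close>, the left inverse of
  \<open>(B', A')\<close> shows that the range of \<open>C\<close> is dense in the initial space of \<open>B'\<close>. This density
  is transported by \<open>\<Phi>\<close>.\<close>

lemma hom_quotient_op_closure:
  assumes pair: "M.quotient_pair A B" and pre: "preclosed_op (quotient_op A B)"
  obtains A' B' where "M.quotient_pair A' B'" "op_closure (quotient_op A B) = quotient_op A' B'"
    "Map.graph (quotient_op (\<Phi> A') (\<Phi> B')) = closure (Map.graph (quotient_op (\<Phi> A) (\<Phi> B)))"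
proof -
  let ?T = "quotient_op A B"
  note hom_pair = hom_quotient_pair[OF pair]
  obtain S where S: "unbounded_op S" and GS: "Map.graph S = closure (Map.graph ?T)"
    using pre by (auto simp: preclosed_op_def)
  have clS: "closed_op S" using S GS by (simp add: closed_op_def)
  have "S \<in> M_aff M"
    by (rule M.closed_invariant_in_M_aff[OF clS])
      (unfold GS, rule M.graph_invariant_closure[OF M.graph_invariant_quotient_op[OF pair]])
  then obtain A' B' where p': "M.quotient_pair A' B'" and S': "S = quotient_op A' B'"
    unfolding M.in_M_aff by blast
  note mem' = M.pair_mem(1)[OF p'] M.pair_mem(2)[OF p']
  note hom_pair' = hom_quotient_pair[OF p']
  have le: "Map.graph ?T \<subseteq> Map.graph (quotient_op A' B')"
    using GS closure_subset unfolding S' by blast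
  obtain C where C: "C \<in> M" "A = A' \<circ> C" "B = B' \<circ> C" "\<And>x. C x \<in> (null_space B')\<^sup>\<bottom>"
    by (rule M.quotient_op_le_factorization[OF pair p' le]) (rule that)
  obtain L1 L2 where L: "L1 \<in> M" "L2 \<in> M" "\<And>x. L1 (B' x) + L2 (A' x) = x - null_proj B' x"
    using clS unfolding S' M.closed_quotient_op_iff[OF p'] by blast
  let ?P = "\<lambda>x. x - null_proj B' x"
  have P: "?P \<in> M" using M.diff_mem[OF M.id_mem M.null_proj_mem[OF mem'(2)]] by simp
  have PC: "?P (C x) = C x" for x
    unfolding null_proj_def using oproj_zero[OF closed_subspace_null_space[OF M.bd[OF mem'(2)]] C(4)] by simp
  let ?L = "\<lambda>z. L1 (fst z) + L2 (snd z)"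
  have "bounded_linear ?L"
    by (intro bounded_linear_add bounded_linear_compose[OF M.bl[OF L(1)] bounded_linear_fst]
        bounded_linear_compose[OF M.bl[OF L(2)] bounded_linear_snd])
  \<comment> \<open>Points of the graph of \<open>A/B\<close> have the form
    \<open>(B' (C x), A' (C x))\<close>, and \<open>?L\<close> sends them to \<open>C x\<close>,
    since \<open>C x\<close> is orthogonal to the kernel of \<open>B'\<close>.\<close>
  then have img: "?L ` closure (Map.graph ?T) \<subseteq> closure (range C)"
    using L(3)[of "C _"] closure_subset[of "range C"] unfolding M.pair_graph[OF pair]
    by (intro image_closure_subset linear_continuous_on) (auto simp: C(2,3) PC)
  have "range ?P \<subseteq> closure (range C)"
  proof clarify
    fix x
    have "(B' x, A' x) \<in> closure (Map.graph ?T)"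
      unfolding GS[symmetric] S' M.pair_graph[OF p'] by simp
    then have "?L (B' x, A' x) \<in> closure (range C)" using img by blast
    then show "?P x \<in> closure (range C)" by (simp add: L(3))
  qed
  then have dense: "range (\<Phi> ?P) \<subseteq> closure (range (\<Phi> C))" by (rule hom_range_closure_mono[OF P C(1)])
  have "A' \<circ> ?P = A'" "B' \<circ> ?P = B'" using M.pair_null_proj[OF p'] by auto
  then have hP: "\<Phi> A' (\<Phi> ?P y) = \<Phi> A' y" "\<Phi> B' (\<Phi> ?P y) = \<Phi> B' y" for y
    using hom_comp[OF mem'(1) P] hom_comp[OF mem'(2) P] by (metis comp_apply)+
  have hAB: "\<Phi> A = \<Phi> A' \<circ> \<Phi> C" "\<Phi> B = \<Phi> B' \<circ> \<Phi> C"
    using C hom_comp mem' by auto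
  let ?K = "\<lambda>y. (\<Phi> B' y, \<Phi> A' y)"
  have "bounded_linear ?K" by (intro bounded_linear_Pair N.bl hom_mem mem')
  \<comment> \<open>Every value of \<open>?K\<close> is already attained on the range of
    \<open>\<Phi> ?P\<close>, where the density of the range of \<open>\<Phi> C\<close>
    applies.\<close>
  then have "?K ` closure (range (\<Phi> C)) \<subseteq> closure (Map.graph (quotient_op (\<Phi> A) (\<Phi> B)))"
    unfolding N.pair_graph[OF hom_pair] by (intro image_closure_subset linear_continuous_on)
      (auto simp: hAB intro!: closure_subset[THEN subsetD])
  then have "?K (\<Phi> ?P y) \<in> closure (Map.graph (quotient_op (\<Phi> A) (\<Phi> B)))" for y using dense by blast
  then have sub: "Map.graph (quotient_op (\<Phi> A') (\<Phi> B')) \<subseteq> closure (Map.graph (quotient_op (\<Phi> A) (\<Phi> B)))"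
    unfolding N.pair_graph[OF hom_pair'] by (auto simp: hP)
  have "closed_op (quotient_op (\<Phi> A') (\<Phi> B'))"
    using hom_quotient_op_closed[OF p'] clS S' by simp
  \<comment> \<open>The opposite inclusion: the image of \<open>A'/B'\<close> extends the image of
    \<open>A/B\<close> and is closed.\<close>
  then have "closure (Map.graph (quotient_op (\<Phi> A) (\<Phi> B))) \<subseteq> Map.graph (quotient_op (\<Phi> A') (\<Phi> B'))"
    using hom_quotient_op_mono[OF pair p' le] by (intro closure_minimal) (auto simp: closed_op_def)
  moreover have "op_closure ?T = quotient_op A' B'" using op_closure_eq[OF S GS] S' by simp
  ultimately show thesis using that p' sub by blast
qed

end

theorem theorem5p5:
  fixes M :: "('a::complex_hilbert \<Rightarrow> 'a) set"
    and N :: "('b::complex_hilbert \<Rightarrow> 'b) set"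
    and \<Phi> :: "('a \<Rightarrow> 'a) \<Rightarrow> ('b \<Rightarrow> 'b)"
  assumes "von_neumann_algebra M"
    and "von_neumann_algebra N"
    and "star_homomorphism M N \<Phi>"
    and "unital_map \<Phi>"
    and "normal_map M N \<Phi>"
  shows "(\<forall>T\<in>M_aff M.
            (dom (Phi_aff M \<Phi> T) = Phi_aff_s M \<Phi> (dom T) \<and>
             (densely_defined T \<longrightarrow> densely_defined (Phi_aff M \<Phi> T))) \<and>
            (closed_op T \<and> bounded_on_dom T \<longrightarrow>
               closed_op (Phi_aff M \<Phi> T) \<and> bounded_on_dom (Phi_aff M \<Phi> T)) \<and>
            (closed_op T \<longrightarrow> closed_op (Phi_aff M \<Phi> T)) \<and>
            (preclosed_op T \<longrightarrow>
               preclosed_op (Phi_aff M \<Phi> T) \<and>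
               op_closure T \<in> M_aff M \<and>
               Phi_aff M \<Phi> (op_closure T) = op_closure (Phi_aff M \<Phi> T))) \<and>
         Phi_aff M \<Phi> ` M_aff_MvN M \<subseteq> M_aff_MvN N \<and>
         Phi_aff M \<Phi> ` {T \<in> M_aff_MvN M. densely_defined T}
           \<subseteq> {S \<in> M_aff_MvN N. densely_defined S}"
proof -
  interpret normal_unital_hom M N \<Phi>
    using assms by (simp add: normal_unital_hom_def normal_unital_hom_axioms_def von_neumann_def)
  have dense: "densely_defined (Phi_aff M \<Phi> T)" if "T \<in> M_aff M" "densely_defined T" for T
    using that hom_quotient_op_densely_defined by (auto simp: M.in_M_aff Phi_aff_quotient_op)
  have closed: "closed_op (Phi_aff M \<Phi> T)" if "T \<in> M_aff M" "closed_op T" for T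
    using that hom_quotient_op_closed by (auto simp: M.in_M_aff Phi_aff_quotient_op)
  have bounded: "bounded_on_dom (Phi_aff M \<Phi> T)" if "T \<in> M_aff M" "closed_op T" "bounded_on_dom T" for T
    using that hom_quotient_op_bounded by (auto simp: M.in_M_aff Phi_aff_quotient_op)
  have aff: "Phi_aff M \<Phi> T \<in> M_aff N" if "T \<in> M_aff M" for T
    using that hom_quotient_pair unfolding M.in_M_aff N.in_M_aff by (metis Phi_aff_quotient_op)
  have dom: "dom (Phi_aff M \<Phi> T) = Phi_aff_s M \<Phi> (dom T)" if T: "T \<in> M_aff M" for T
  proof -
    obtain A B where p: "M.quotient_pair A B" and T: "T = quotient_op A B" using T unfolding M.in_M_aff by blast
    show ?thesis
      unfolding T Phi_aff_quotient_op[OF p] M.pair_dom[OF p] N.pair_dom[OF hom_quotient_pair[OF p]]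
        Phi_aff_s_range[OF M.pair_mem(2)[OF p]] ..
  qed
  have closure: "preclosed_op (Phi_aff M \<Phi> T) \<and> op_closure T \<in> M_aff M \<and>
      Phi_aff M \<Phi> (op_closure T) = op_closure (Phi_aff M \<Phi> T)"
    if T: "T \<in> M_aff M" and pc: "preclosed_op T" for T
  proof -
    obtain A B where p: "M.quotient_pair A B" and T: "T = quotient_op A B" using T unfolding M.in_M_aff by blast
    obtain A' B' where p': "M.quotient_pair A' B'" and cl: "op_closure T = quotient_op A' B'"
      and G: "Map.graph (quotient_op (\<Phi> A') (\<Phi> B')) = closure (Map.graph (quotient_op (\<Phi> A) (\<Phi> B)))"
      using hom_quotient_op_closure[OF p] pc unfolding T by blast
    note u = N.pair_unbounded_op[OF hom_quotient_pair[OF p']]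
    have "preclosed_op (quotient_op (\<Phi> A) (\<Phi> B))"
      unfolding preclosed_op_def using u G N.pair_unbounded_op[OF hom_quotient_pair[OF p]] by blast
    moreover have "op_closure T \<in> M_aff M" using cl p' M.in_M_aff by blast
    ultimately show ?thesis
      unfolding cl Phi_aff_quotient_op[OF p'] unfolding T Phi_aff_quotient_op[OF p] op_closure_eq[OF u G] by simp
  qed
  show ?thesis
    unfolding M.M_aff_MvN_eq N.M_aff_MvN_eq using dom dense closed bounded closure aff by auto
qed

end
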